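(* There is an absolute constant $C$ such that for every integer $k\geq 2$ there exist two non-isomorphic graphs, each of twin-width at most $4$ and with at most $C\,k\log k$ vertices, which are not distinguished by the $k$-dimensional Weisfeiler-Leman algorithm. (That is: for all $k$ there are such pairs of size $O(k\log k)$.)
   Context: All graphs are finite and simple. Trigraphs are graphs whose edges are colored red or black; a graph is a trigraph with only black edges. For a partition $\mathcal P$ of $V(G)$, the quotient trigraph $G/\mathcal P$ has vertex set $\mathcal P$; two parts $U,W$ are joined by a black edge if every vertex of $U$ is adjacent to every vertex of $W$, are non-adjacent if no vertex of $U$ is adjacent to a vertex of $W$, and are joined by a red edge otherwise. A partition sequence of an $n$-vertex graph $G$ is a sequence $\mathcal P_n,\dots,\mathcal P_1$ of partitions of $V(G)$ where $\mathcal P_n$ is the partition into singletons and each $\mathcal P_i$ arises from $\mathcal P_{i+1}$ by merging two parts; its width is the maximum number of red edges at a vertex over all $G/\mathcal P_i$. The twin-width of $G$ is the minimum width of a partition sequence. The $k$-dimensional Weisfeiler-Leman algorithm ($k$-WL) iteratively refines the coloring of $V(G)^k$ by atomic types via $\chi^{i+1}(\vec v)=(\chi^i(\vec v),\{\!\{(\mathrm{atp}(\vec v w),\chi^i(\vec v[w/1]),\dots,\chi^i(\vec v[w/k])):w\in V(G)\}\!\})$ until stable; it distinguishes $G$ and $H$ if some stable color occurs a different number of times on $V(G)^k$ and $V(H)^k$. *)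

theory Defs
  imports
    Complex_Main
    "HOL-Library.Multiset"
    "HOL-Library.Disjoint_Sets"
    "Graph_Theory.Pair_Digraph"
    "Graph_Theory.Digraph_Isomorphism"
begin

text \<open>
  Finite simple graphs are the \<^locale>\<open>pair_graph\<close>s of the AFP entry Graph Theory: finite, loop-free,
  symmetric digraphs without parallel arcs. The relation \<^const>\<open>parcs\<close> contains both
  orientations of every edge.
\<close>

section \<open>Trigraphs and twin-width\<close>

text \<open>Edge relations of trigraphs are symmetric as well.\<close>

record 'a trigraph =
  tri_verts :: "'a set"
  black_edges :: "'a rel"
  red_edges :: "'a rel"

definition quotient_trigraph :: "'a pair_pre_digraph \<Rightarrow> 'a set set \<Rightarrow> 'a set trigraph" where
  "quotient_trigraph G \<P> = \<lparr>
     tri_verts = \<P>,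
     black_edges = {(U, W). U \<in> \<P> \<and> W \<in> \<P> \<and> U \<noteq> W \<and>
       (\<forall>u\<in>U. \<forall>w\<in>W. (u, w) \<in> parcs G)},
     red_edges = {(U, W). U \<in> \<P> \<and> W \<in> \<P> \<and> U \<noteq> W \<and>
       \<not> (\<forall>u\<in>U. \<forall>w\<in>W. (u, w) \<in> parcs G) \<and>
       \<not> (\<forall>u\<in>U. \<forall>w\<in>W. (u, w) \<notin> parcs G)}\<rparr>"

definition red_degree :: "'a trigraph \<Rightarrow> 'a \<Rightarrow> nat" where
  "red_degree T v = card {w. (v, w) \<in> red_edges T}"

definition merges_two_parts :: "'a set set \<Rightarrow> 'a set set \<Rightarrow> bool" where
  "merges_two_parts \<P> \<Q> \<longleftrightarrow>
     (\<exists>A\<in>\<P>. \<exists>B\<in>\<P>. A \<noteq> B \<and> \<Q> = insert (A \<union> B) (\<P> - {A, B}))"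

text \<open>Only the values of \<open>\<P>\<close> at the indices \<open>1, \<dots>, n\<close> matter, where \<open>n\<close> is the number of vertices.\<close>

definition partition_sequence :: "'a pair_pre_digraph \<Rightarrow> (nat \<Rightarrow> 'a set set) \<Rightarrow> bool" where
  "partition_sequence G \<P> \<longleftrightarrow>
     (let n = card (pverts G) in
       (\<forall>i\<in>{1..n}. partition_on (pverts G) (\<P> i)) \<and>
       \<P> n = (\<lambda>v. {v}) ` pverts G \<and>
       (\<forall>i\<in>{1..<n}. merges_two_parts (\<P> (Suc i)) (\<P> i)))"

text \<open>
  On finite sets of natural numbers, \<open>Sup\<close> is the maximum, with value \<open>0\<close> for the empty set
  (which occurs only for the graph without vertices).
\<close>

definition sequence_width :: "'a pair_pre_digraph \<Rightarrow> (nat \<Rightarrow> 'a set set) \<Rightarrow> nat" where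
  "sequence_width G \<P> =
     (SUP i\<in>{1..card (pverts G)}.
       SUP U\<in>tri_verts (quotient_trigraph G (\<P> i)). red_degree (quotient_trigraph G (\<P> i)) U)"

definition twin_width :: "'a pair_pre_digraph \<Rightarrow> nat" where
  "twin_width G = (LEAST d. \<exists>\<P>. partition_sequence G \<P> \<and> sequence_width G \<P> = d)"

section \<open>The Weisfeiler-Leman algorithm\<close>

text \<open>The set of vertex tuples of length \<open>k\<close>; positions are counted from \<open>0\<close>.\<close>

definition tuples :: "nat \<Rightarrow> 'a pair_pre_digraph \<Rightarrow> 'a list set" where
  "tuples k G = {vs. set vs \<subseteq> pverts G \<and> length vs = k}"

text \<open>The pairs of positions with equal entries, and those with adjacent entries.\<close>

type_synonym atomic_type = "nat rel \<times> nat rel"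

definition atp :: "'a pair_pre_digraph \<Rightarrow> 'a list \<Rightarrow> atomic_type" where
  "atp G vs =
     ({(i, j). i < length vs \<and> j < length vs \<and> vs ! i = vs ! j},
      {(i, j). i < length vs \<and> j < length vs \<and> (vs ! i, vs ! j) \<in> parcs G})"

text \<open>Colors do not refer to vertices, so colors of different graphs can be compared.\<close>

datatype wl_color =
    Initial atomic_type
  | Refined wl_color "(atomic_type \<times> wl_color list) multiset"

text \<open>The dimension \<open>k\<close> is the length of the tuple \<open>vs\<close>.\<close>

primrec wl_coloring :: "'a pair_pre_digraph \<Rightarrow> nat \<Rightarrow> 'a list \<Rightarrow> wl_color" where
  "wl_coloring G 0 = (\<lambda>vs. Initial (atp G vs))"
| "wl_coloring G (Suc i) = (\<lambda>vs. Refined (wl_coloring G i vs)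
     {# (atp G (vs @ [w]), map (\<lambda>j. wl_coloring G i (vs[j := w])) [0..<length vs]).
        w \<in># mset_set (pverts G) #})"

text \<open>
  Both graphs are colored in parallel, and stability refers to the common coloring of the disjoint
  union of the two sets of tuples. Stability on each graph separately would not suffice: two
  regular graphs of different degree are both stable after round \<open>0\<close> of the one-dimensional
  algorithm, with the same number of vertices of each color if they have the same order.
\<close>

definition wl_stable :: "nat \<Rightarrow> 'a pair_pre_digraph \<Rightarrow> 'a pair_pre_digraph \<Rightarrow> nat \<Rightarrow> bool" where
  "wl_stable k G H i \<longleftrightarrow>
     (\<forall>F\<in>{G, H}. \<forall>F'\<in>{G, H}. \<forall>vs\<in>tuples k F. \<forall>ws\<in>tuples k F'.
        wl_coloring F (Suc i) vs = wl_coloring F' (Suc i) ws \<longleftrightarrow>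
        wl_coloring F i vs = wl_coloring F' i ws)"

definition wl_stable_round :: "nat \<Rightarrow> 'a pair_pre_digraph \<Rightarrow> 'a pair_pre_digraph \<Rightarrow> nat" where
  "wl_stable_round k G H = (LEAST i. wl_stable k G H i)"

definition wl_distinguishes :: "nat \<Rightarrow> 'a pair_pre_digraph \<Rightarrow> 'a pair_pre_digraph \<Rightarrow> bool" where
  "wl_distinguishes k G H \<longleftrightarrow>
     (let r = wl_stable_round k G H in
       \<exists>c. card {vs \<in> tuples k G. wl_coloring G r vs = c} \<noteq>
           card {vs \<in> tuples k H. wl_coloring H r vs = c})"

end

theory Submission
  imports Defs "HOL-Library.Countable"
begin

text \<open>
  The graphs are the untwisted and the twisted CFI graph over a wrapped network with \<open>d\<close> levels of
  \<open>2 ^ d\<close> rows, where \<open>2 ^ d\<close> is proportional to \<open>k\<close>.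

  The network is robust: for every pair of rows there is a path around the levels, and every vertex
  lies on at most \<open>2 * 2 ^ d\<close> of these \<open>4 ^ d\<close> paths. After deleting fewer than \<open>2 ^ d / 4\<close> vertices,
  some rows still reach more than half of all rows, and all such rows are connected with each other.
  Duplicator keeps the twist among them, hence the CFI graphs are equivalent for \<open>k\<close>-WL.

  They are not isomorphic because the base graph has more homomorphisms to the untwisted than to
  the twisted CFI graph.

  Twin-width at most 4 comes from contracting the fibers, then repeatedly merging the rows that agree
  modulo \<open>2 ^ j\<close> for \<open>j = d - 1, \<dots>, 0\<close>, and finally the remaining cycle of levels. This stays
  sparse since wires have degree 2 in the base graph and are merged before their ends.
\<close>

section \<open>Contraction sequences from colorings\<close>

text \<open>Over a bounded-degree expander the same construction gives pairs of linear size, but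
  cubic graphs have unbounded twin-width. The network is a compromise: it has degree at most 3 and
  is hard to separate, yet its rows fold modulo powers of two. The price is the number
  \<open>d\<close> of levels, which is the logarithmic factor.

  The contraction sequence is constructed backwards, from the one-part partition to the singletons,
  by refining colorings. Each move bounds the red degrees of all partitions between two colorings at
  once, so the moves must be small enough that four colors suffice around every class.

  An isomorphism of the two graphs need not map fibers to fibers. Homomorphisms from the base graph
  are transported by it all the same, which reduces non-isomorphism to parity and counting.\<close>

definition tri_ok :: "nat \<Rightarrow> 'a pair_pre_digraph \<Rightarrow> 'a set set \<Rightarrow> bool" where
  "tri_ok d G P \<longleftrightarrow> (\<forall>U\<in>P. red_degree (quotient_trigraph G P) U \<le> d)"

text \<open>Building from the coarse end lets a finer partition be put in front of a finished
  sequence, together with its own red degree bound.\<close>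

inductive contractible :: "nat \<Rightarrow> 'a pair_pre_digraph \<Rightarrow> 'a set set \<Rightarrow> bool" for d G where
  single: "partition_on (pverts G) P \<Longrightarrow> tri_ok d G P \<Longrightarrow> card P = 1 \<Longrightarrow> contractible d G P"
| merge: "partition_on (pverts G) P \<Longrightarrow> tri_ok d G P \<Longrightarrow> merges_two_parts P Q \<Longrightarrow>
    contractible d G Q \<Longrightarrow> contractible d G P"

lemma merge_parts_partition_on:
  assumes P: "partition_on V P" and A: "A \<in> P" "B \<in> P" "A \<noteq> B"
  shows "partition_on V (insert (A \<union> B) (P - {A, B}))"
proof (rule partition_onI)
  show "\<Union> (insert (A \<union> B) (P - {A, B})) = V"
    using partition_onD1[OF P] A by auto
  show "{} \<notin> insert (A \<union> B) (P - {A, B})"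
    using partition_onD3[OF P] A by auto
  have disj: "X \<inter> Y = {}" if "X \<in> P" "Y \<in> P" "X \<noteq> Y" for X Y
    using partition_onD2[OF P] that by (rule disjointD)
  fix X Y assume XY: "X \<in> insert (A \<union> B) (P - {A, B})" "Y \<in> insert (A \<union> B) (P - {A, B})" "X \<noteq> Y"
  show "disjnt X Y"
  proof (cases "X = A \<union> B")
    case True
    then have "Y \<in> P" "A \<noteq> Y" "B \<noteq> Y" using XY by auto
    then show ?thesis using disj[OF A(1)] disj[OF A(2)] True by (simp add: disjnt_def Int_Un_distrib2)
  next
    case X: False
    then have X': "X \<in> P" "X \<noteq> A" "X \<noteq> B" using XY by auto
    show ?thesis
    proof (cases "Y = A \<union> B")
      case True
      then show ?thesis using disj[OF X'(1) A(1)] disj[OF X'(1) A(2)] X'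
        by (simp add: disjnt_def Int_Un_distrib)
    next
      case False
      then show ?thesis using disj[OF X'(1)] XY by (simp add: disjnt_def)
    qed
  qed
qed

lemma card_merge_parts:
  assumes P: "partition_on V P" and V: "finite V" and A: "A \<in> P" "B \<in> P" "A \<noteq> B"
  shows "card P = Suc (card (insert (A \<union> B) (P - {A, B})))"
proof -
  have fin: "finite P" using finite_elements[OF V P] .
  have "A \<union> B \<notin> P - {A, B}"
  proof
    assume *: "A \<union> B \<in> P - {A, B}"
    then have "(A \<union> B) \<inter> A = {}" by (intro disjointD[OF partition_onD2[OF P]] A) auto
    then have "A = {}" by (simp add: Int_absorb1)
    then show False using A(1) partition_onD3[OF P] by simp
  qed
  then have "card (insert (A \<union> B) (P - {A, B})) = Suc (card (P - {A, B}))" using fin by simp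
  also have "\<dots> = Suc (card P - 2)" using A fin by (simp add: card_Diff_subset)
  also have "Suc \<dots> = card P"
  proof -
    have "card {A, B} \<le> card P" by (rule card_mono[OF fin]) (simp add: A)
    then show ?thesis using A(3) by simp
  qed
  finally show ?thesis by simp
qed

text \<open>A merge lowers the number of parts by exactly one, so placing each partition at the
  index given by its number of parts yields the indexing of
  \<open>partition_sequence\<close>.\<close>

lemma contractible_sequence:
  assumes V: "finite (pverts G)"
  shows "contractible d G P \<Longrightarrow> \<exists>\<P>. \<P> (card P) = P \<and>
    (\<forall>i\<in>{1..card P}. partition_on (pverts G) (\<P> i) \<and> tri_ok d G (\<P> i)) \<and>
    (\<forall>i\<in>{1..<card P}. merges_two_parts (\<P> (Suc i)) (\<P> i))"
proof (induction rule: contractible.induct)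
  case (single P)
  then show ?case by (intro exI[of _ "\<lambda>_. P"]) auto
next
  case (merge P Q)
  from merge.IH obtain \<Q> where Q: "\<Q> (card Q) = Q"
      "\<forall>i\<in>{1..card Q}. partition_on (pverts G) (\<Q> i) \<and> tri_ok d G (\<Q> i)"
      "\<forall>i\<in>{1..<card Q}. merges_two_parts (\<Q> (Suc i)) (\<Q> i)"
    by blast
  have card: "card P = Suc (card Q)"
    using merge.hyps(3) card_merge_parts[OF merge.hyps(1) V] unfolding merges_two_parts_def by blast
  show ?case
  proof (intro exI[of _ "\<Q>(Suc (card Q) := P)"] conjI ballI)
    fix i assume i: "i \<in> {1..card P}"
    show "partition_on (pverts G) ((\<Q>(Suc (card Q) := P)) i)"
      using i Q merge.hyps card by (cases "i = Suc (card Q)") auto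
    show "tri_ok d G ((\<Q>(Suc (card Q) := P)) i)"
      using i Q merge.hyps card by (cases "i = Suc (card Q)") auto
  next
    fix i assume i: "i \<in> {1..<card P}"
    show "merges_two_parts ((\<Q>(Suc (card Q) := P)) (Suc i)) ((\<Q>(Suc (card Q) := P)) i)"
      using i Q merge.hyps card by (cases "i = card Q") auto
  qed (simp add: card)
qed

lemma twin_width_le:
  assumes V: "finite (pverts G)" "pverts G \<noteq> {}"
    and c: "contractible d G ((\<lambda>v. {v}) ` pverts G)"
  shows "twin_width G \<le> d"
proof -
  have card: "card ((\<lambda>v. {v}) ` pverts G) = card (pverts G)"
    by (intro card_image) (auto simp: inj_on_def)
  obtain \<P> where P: "\<P> (card (pverts G)) = (\<lambda>v. {v}) ` pverts G"
    "\<forall>i\<in>{1..card (pverts G)}. partition_on (pverts G) (\<P> i) \<and> tri_ok d G (\<P> i)"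
    "\<forall>i\<in>{1..<card (pverts G)}. merges_two_parts (\<P> (Suc i)) (\<P> i)"
    using contractible_sequence[OF V(1) c] unfolding card by blast
  have ps: "partition_sequence G \<P>" unfolding partition_sequence_def Let_def using P by auto
  have ne: "card (pverts G) \<ge> 1" using V by (simp add: Suc_leI card_gt_0_iff)
  have "sequence_width G \<P> \<le> d"
    unfolding sequence_width_def
  proof (rule cSUP_least)
    show "{1..card (pverts G)} \<noteq> {}" using ne by simp
  next
    fix i assume i: "i \<in> {1..card (pverts G)}"
    have "\<Union> (\<P> i) = pverts G" using P(2) i partition_onD1 by blast
    then have "\<P> i \<noteq> {}" using V(2) by auto
    then show "(SUP U\<in>tri_verts (quotient_trigraph G (\<P> i)). red_degree (quotient_trigraph G (\<P> i)) U) \<le> d"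
      using P(2) i by (intro cSUP_least) (auto simp: quotient_trigraph_def tri_ok_def)
  qed
  moreover have "twin_width G \<le> sequence_width G \<P>"
    unfolding twin_width_def using ps by (intro Least_le) blast
  ultimately show ?thesis by simp
qed

text \<open>A partition strictly finer than \<open>Q\<close> has two parts inside one part of
  \<open>Q\<close>, as otherwise \<open>Q\<close> would refine it in turn. Merging those two stays
  below \<open>Q\<close>, so any order of such merges ends in \<open>Q\<close>. All partitions on
  the way lie between \<open>P\<close> and \<open>Q\<close>, where \<open>ok\<close> covers
  them.\<close>

lemma contractible_refines:
  assumes V: "finite V" "V = pverts G" and Q: "contractible d G Q"
    and ok: "\<And>M. refines V P M \<Longrightarrow> refines V M Q \<Longrightarrow> tri_ok d G M"
    and PQ: "refines V P Q"
  shows "contractible d G P"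
  using ok PQ
proof (induction "card P" arbitrary: P rule: less_induct)
  case less
  have pP: "partition_on V P" and pQ: "partition_on V Q" using less.prems by (auto simp: refines_def)
  have okP: "tri_ok d G P" using less.prems refines_refl[OF pP] by blast
  show ?case
  proof (cases "P = Q")
    case False
    have PQ: "\<exists>Y\<in>Q. X \<subseteq> Y" if "X \<in> P" for X using less.prems(2) that by (simp add: refines_def)
    have disj: "X = Y" if "X \<in> Q" "Y \<in> Q" "x \<in> X" "x \<in> Y" for X Y x
      using disjointD[OF partition_onD2[OF pQ] that(1,2)] that(3,4) by blast
    have "\<exists>A\<in>P. \<exists>B\<in>P. \<exists>C\<in>Q. A \<noteq> B \<and> A \<subseteq> C \<and> B \<subseteq> C"
    proof (rule ccontr)
      assume "\<not> ?thesis"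
      then have no: "A = B" if "A \<in> P" "B \<in> P" "C \<in> Q" "A \<subseteq> C" "B \<subseteq> C" for A B C
        using that by metis
      have "\<exists>D\<in>P. C \<subseteq> D" if C: "C \<in> Q" for C
      proof -
        have in_C: "\<exists>A\<in>P. x \<in> A \<and> A \<subseteq> C" if x: "x \<in> C" for x
        proof -
          have "x \<in> \<Union>P" using x C partition_onD1[OF pP] partition_onD1[OF pQ] by blast
          then obtain A where A: "A \<in> P" "x \<in> A" by blast
          from PQ[OF A(1)] obtain C' where C': "C' \<in> Q" "A \<subseteq> C'" by blast
          then have "C' = C" using disj[OF C'(1) C _ x] A(2) by blast
          then show ?thesis using A C' by blast
        qed
        have "C \<noteq> {}" using C partition_onD3[OF pQ] by blast
        then obtain x where "x \<in> C" by blast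
        from in_C[OF this] obtain A where A: "A \<in> P" "A \<subseteq> C" by blast
        have "C \<subseteq> A"
        proof
          fix y assume "y \<in> C"
          from in_C[OF this] obtain B where B: "B \<in> P" "y \<in> B" "B \<subseteq> C" by blast
          then show "y \<in> A" using no[OF A(1) B(1) C A(2) B(3)] by simp
        qed
        then show ?thesis using A(1) by (rule bexI)
      qed
      then have "refines V Q P" using pP pQ by (simp add: refines_def)
      then show False using False refines_asym[OF less.prems(2)] by simp
    qed
    then obtain A B C where AB: "A \<in> P" "B \<in> P" "A \<noteq> B" and C: "C \<in> Q" "A \<subseteq> C" "B \<subseteq> C"
      by (elim bexE conjE)
    define P' where "P' = insert (A \<union> B) (P - {A, B})"
    have pP': "partition_on V P'" unfolding P'_def by (rule merge_parts_partition_on[OF pP AB])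
    have "\<exists>Y\<in>P'. X \<subseteq> Y" if "X \<in> P" for X
      using that unfolding P'_def by (cases "X = A \<or> X = B") auto
    then have PP': "refines V P P'" using pP pP' by (simp add: refines_def)
    have "\<exists>Y\<in>Q. X \<subseteq> Y" if "X \<in> P'" for X
    proof (cases "X = A \<union> B")
      case True
      then show ?thesis using C by (intro bexI[of _ C]) simp_all
    qed (use that PQ in \<open>simp add: P'_def\<close>)
    then have P'Q: "refines V P' Q" using pP' pQ by (simp add: refines_def)
    have "contractible d G P'"
    proof (rule less.hyps)
      show "card P' < card P" unfolding P'_def using card_merge_parts[OF pP V(1) AB] by simp
      show "tri_ok d G M" if "refines V P' M" "refines V M Q" for M
        using less.prems(1)[OF refines_trans[OF PP' that(1)] that(2)] .
    qed (fact P'Q)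
    moreover have "merges_two_parts P P'" using AB unfolding merges_two_parts_def P'_def by blast
    ultimately show ?thesis using contractible.merge[OF pP[unfolded V(2)] okP] by blast
  qed (use Q in simp)
qed

section \<open>Partitions into color classes\<close>

definition color_partition :: "'a set \<Rightarrow> ('a \<Rightarrow> 'b) \<Rightarrow> 'a set set" where
  "color_partition V f = (\<lambda>x. {y \<in> V. f y = f x}) ` V"

lemma partition_on_color_partition: "partition_on V (color_partition V f)"
  by (rule partition_onI) (auto simp: color_partition_def disjnt_def)

lemma color_partition_cong:
  assumes "\<And>x y. x \<in> V \<Longrightarrow> y \<in> V \<Longrightarrow> f x = f y \<longleftrightarrow> g x = g y"
  shows "color_partition V f = color_partition V g"
  unfolding color_partition_def
proof (rule image_cong[OF refl])
  fix x assume "x \<in> V"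
  then show "{y \<in> V. f y = f x} = {y \<in> V. g y = g x}" using assms[OF _ \<open>x \<in> V\<close>] by blast
qed

lemma color_partition_inj:
  assumes "inj_on f V" shows "color_partition V f = (\<lambda>v. {v}) ` V"
  unfolding color_partition_def
proof (rule image_cong[OF refl])
  fix x assume "x \<in> V"
  then show "{y \<in> V. f y = f x} = {x}" using inj_onD[OF assms] by blast
qed

lemma card_le_4: "A \<subseteq> {a, b, c, e} \<Longrightarrow> card A \<le> 4"
  by (rule order_trans[OF card_mono[of "{a, b, c, e}"]]) (auto simp: card_insert_if)

lemma contractible_const:
  assumes "pverts G \<noteq> {}" and const: "\<And>x y. x \<in> pverts G \<Longrightarrow> y \<in> pverts G \<Longrightarrow> f x = f y"
  shows "contractible d G (color_partition (pverts G) f)"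
proof (rule contractible.single)
  have "{y \<in> pverts G. f y = f x} = pverts G" if "x \<in> pverts G" for x
    using const[OF _ that] by blast
  then have eq: "color_partition (pverts G) f = {pverts G}"
    unfolding color_partition_def using assms(1) by (simp add: image_constant_conv cong: image_cong)
  show "tri_ok d G (color_partition (pverts G) f)" "card (color_partition (pverts G) f) = 1"
    unfolding eq by (auto simp: tri_ok_def red_degree_def quotient_trigraph_def intro: card_eq_0_iff[THEN iffD2, THEN eq_imp_le, THEN order_trans])
qed (rule partition_on_color_partition)

text \<open>
  All partitions between the colorings \<open>f\<close> and \<open>g\<close> are covered at once: their parts are contained
  in color classes of \<open>g\<close>, and distinct parts have distinct \<open>f\<close>-colors. A neighbor
  whose \<open>g\<close>-class is completely joined to the class of \<open>x\<close> only contributes black edges.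
\<close>

lemma contractible_coarser_coloring:
  assumes fin: "finite (pverts G)"
    and fg: "\<And>x y. x \<in> pverts G \<Longrightarrow> y \<in> pverts G \<Longrightarrow> f x = f y \<Longrightarrow> g x = g y"
    and g: "contractible 4 G (color_partition (pverts G) g)"
    and nb: "\<And>x. x \<in> pverts G \<Longrightarrow> \<exists>a b c e. \<forall>y w. y \<in> pverts G \<longrightarrow> w \<in> pverts G \<longrightarrow> g y = g x \<longrightarrow>
      (y, w) \<in> parcs G \<longrightarrow>
      (\<exists>y' w'. y' \<in> pverts G \<and> w' \<in> pverts G \<and> g y' = g x \<and> g w' = g w \<and> (y', w') \<notin> parcs G) \<longrightarrow>
      f w \<in> {a, b, c, e}"
  shows "contractible 4 G (color_partition (pverts G) f)"
proof (rule contractible_refines[OF fin refl g])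
  let ?V = "pverts G"
  have "\<exists>Y\<in>color_partition ?V g. X \<subseteq> Y" if X: "X \<in> color_partition ?V f" for X
  proof -
    from X obtain x where x: "x \<in> ?V" "X = {y \<in> ?V. f y = f x}" unfolding color_partition_def by blast
    then have "X \<subseteq> {y \<in> ?V. g y = g x}" using fg[OF _ x(1)] by blast
    moreover have "{y \<in> ?V. g y = g x} \<in> color_partition ?V g"
      using x(1) unfolding color_partition_def by blast
    ultimately show ?thesis by blast
  qed
  then show "refines ?V (color_partition ?V f) (color_partition ?V g)"
    unfolding refines_def using partition_on_color_partition[of ?V f] partition_on_color_partition[of ?V g]
    by blast
  fix M assume fM: "refines ?V (color_partition ?V f) M" and Mg: "refines ?V M (color_partition ?V g)"
  have pM: "partition_on ?V M" using fM by (simp add: refines_def)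
  have MV: "\<And>U x. U \<in> M \<Longrightarrow> x \<in> U \<Longrightarrow> x \<in> ?V" using pM by (auto simp: partition_on_def)
  have Mdisj: "\<And>U W x. U \<in> M \<Longrightarrow> W \<in> M \<Longrightarrow> x \<in> U \<Longrightarrow> x \<in> W \<Longrightarrow> U = W"
    using pM by (auto simp: partition_on_def disjoint_def)
  have gM: "g x = g y" if U: "U \<in> M" and xy: "x \<in> U" "y \<in> U" for U x y
  proof -
    obtain Y where Y: "Y \<in> color_partition ?V g" "U \<subseteq> Y"
      using Mg U unfolding refines_def by blast
    from Y(1) obtain z where "Y = {y \<in> ?V. g y = g z}" unfolding color_partition_def by (elim imageE)
    then have "g x = g z" "g y = g z" using Y(2) xy by auto
    then show ?thesis by simp
  qed
  have same: "y \<in> U" if U: "U \<in> M" "x \<in> U" and y: "f x = f y" "y \<in> ?V" for U x y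
  proof -
    have x: "x \<in> ?V" using MV U .
    then have "{z \<in> ?V. f z = f x} \<in> color_partition ?V f"
      unfolding color_partition_def by blast
    then obtain Y where Y: "Y \<in> M" "{z \<in> ?V. f z = f x} \<subseteq> Y" using fM by (auto simp: refines_def)
    then have "x \<in> Y" "y \<in> Y" using x y by auto
    then show ?thesis using Mdisj[OF U(1) Y(1) U(2)] by simp
  qed
  show "tri_ok 4 G M" unfolding tri_ok_def
  proof
    fix U assume U: "U \<in> M"
    then have "U \<noteq> {}" using pM by (auto simp: partition_on_def)
    then obtain x where x: "x \<in> U" by blast
    obtain a b c e where ab: "\<forall>y w. y \<in> ?V \<longrightarrow> w \<in> ?V \<longrightarrow> g y = g x \<longrightarrow> (y, w) \<in> parcs G \<longrightarrow>
      (\<exists>y' w'. y' \<in> ?V \<and> w' \<in> ?V \<and> g y' = g x \<and> g w' = g w \<and> (y', w') \<notin> parcs G) \<longrightarrow>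
      f w \<in> {a, b, c, e}"
      using nb[OF MV[OF U x]] by (elim exE) (rule that)
    let ?R = "{W. (U, W) \<in> red_edges (quotient_trigraph G M)}"
    have "\<exists>w. w \<in> W \<and> f w \<in> {a, b, c, e}" if "W \<in> ?R" for W
    proof -
      from that have W: "W \<in> M"
        and "\<not> (\<forall>u\<in>U. \<forall>w\<in>W. (u, w) \<in> parcs G)" "\<not> (\<forall>u\<in>U. \<forall>w\<in>W. (u, w) \<notin> parcs G)"
        by (auto simp: quotient_trigraph_def)
      then obtain u w u' w' where *: "u \<in> U" "w \<in> W" "(u, w) \<in> parcs G" "u' \<in> U" "w' \<in> W" "(u', w') \<notin> parcs G"
        by blast
      then have "\<exists>y' w'. y' \<in> ?V \<and> w' \<in> ?V \<and> g y' = g x \<and> g w' = g w \<and> (y', w') \<notin> parcs G"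
        using MV[OF U *(4)] MV[OF W *(5)] gM[OF U *(4) x] gM[OF W *(5,2)] by blast
      then have "f w \<in> {a, b, c, e}"
        by (rule ab[rule_format, OF MV[OF U *(1)] MV[OF W *(2)] gM[OF U *(1) x] *(3)])
      then show ?thesis using * by blast
    qed
    then have "\<forall>W\<in>?R. \<exists>w. w \<in> W \<and> f w \<in> {a, b, c, e}" by (rule ballI)
    from bchoice[OF this] obtain r where r: "\<And>W. W \<in> ?R \<Longrightarrow> r W \<in> W"
      and fr: "\<And>W. W \<in> ?R \<Longrightarrow> f (r W) \<in> {a, b, c, e}" by (elim exE) blast
    have RM: "W \<in> M" if "W \<in> ?R" for W using that by (simp add: quotient_trigraph_def)
    have "inj_on (\<lambda>W. f (r W)) ?R"
    proof (rule inj_onI)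
      fix W W' assume W: "W \<in> ?R" "W' \<in> ?R" "f (r W) = f (r W')"
      have "r W' \<in> W" by (rule same[OF RM[OF W(1)] r[OF W(1)] W(3) MV[OF RM[OF W(2)] r[OF W(2)]]])
      then show "W = W'" by (rule Mdisj[OF RM[OF W(1)] RM[OF W(2)] _ r[OF W(2)]])
    qed
    then have "card ?R = card ((\<lambda>W. f (r W)) ` ?R)" by (simp add: card_image)
    also have "\<dots> \<le> 4" by (rule card_le_4[of _ a b c e], rule image_subsetI, rule fr)
    finally show "red_degree (quotient_trigraph G M) U \<le> 4" by (simp add: red_degree_def)
  qed
qed

section \<open>CFI graphs\<close>

text \<open>Vertices are pairs of a base vertex and a label, coded as numbers because the theorem
  asks for graphs over \<open>nat\<close>. \<open>set_encode\<close> is invertible on finite sets,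
  hence the finiteness condition when a label is decoded.\<close>

definition encode_vertex :: "'v::countable \<Rightarrow> 'v set \<Rightarrow> nat" where
  "encode_vertex v S = prod_encode (to_nat v, set_encode (to_nat ` S))"

definition base_vertex :: "nat \<Rightarrow> 'v::countable" where
  "base_vertex x = from_nat (fst (prod_decode x))"

definition label :: "nat \<Rightarrow> 'v::countable set" where
  "label x = from_nat ` set_decode (snd (prod_decode x))"

lemma base_vertex_encode [simp]: "base_vertex (encode_vertex v S) = v"
  by (simp add: base_vertex_def encode_vertex_def)

lemma label_encode [simp]: "finite S \<Longrightarrow> label (encode_vertex v S) = S"
  by (simp add: label_def encode_vertex_def set_encode_inverse image_image)

lemma odd_card_sym_diff:
  assumes "finite A" "finite B"
  shows "odd (card (sym_diff A B)) \<longleftrightarrow> odd (card A) \<noteq> odd (card B)"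
proof -
  have "card A = card (A - B) + card (A \<inter> B)" "card B = card (B - A) + card (A \<inter> B)"
    using assms by (metis card_Int_Diff add.commute Int_commute)+
  moreover have "card (sym_diff A B) = card (A - B) + card (B - A)"
    using assms by (intro card_Un_disjoint) auto
  ultimately show ?thesis by auto
qed

lemma sym_diff_Image: "sym_diff F P `` {v} = sym_diff (F `` {v}) (P `` {v})"
  by auto

lemma sym_diff_cancel: "sym_diff (sym_diff A B) B = A"
  by auto

lemma sym_sym_diff: "sym F \<Longrightarrow> sym P \<Longrightarrow> sym (sym_diff F P)"
  unfolding sym_def by auto

text \<open>Every undirected edge contributes two ordered pairs; comparing codes under
  \<open>to_nat\<close> picks one of them.\<close>

lemma even_card_sym_irrefl:
  fixes F :: "'v::countable rel"
  assumes "finite F" "sym F" "irrefl F"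
  shows "even (card F)"
proof -
  let ?A = "{(a, b) \<in> F. to_nat a < to_nat b}"
  have "F = ?A \<union> ?A\<inverse>"
  proof (intro equalityI subrelI)
    fix a b assume ab: "(a, b) \<in> F"
    then have "a \<noteq> b" using assms(3) by (auto simp: irrefl_def)
    then have "to_nat a < to_nat b \<or> to_nat b < to_nat a" by (simp add: neq_iff[symmetric])
    then show "(a, b) \<in> ?A \<union> ?A\<inverse>" using ab symD[OF assms(2)] by auto
  next
    fix a b assume "(a, b) \<in> ?A \<union> ?A\<inverse>"
    then show "(a, b) \<in> F" using symD[OF assms(2)] by auto
  qed
  moreover have "card (?A \<union> ?A\<inverse>) = card ?A + card (?A\<inverse>)"
    using assms(1) by (intro card_Un_disjoint) (auto intro: finite_subset[of _ F])
  ultimately have "card F = card ?A + card ?A" by (simp add: card_inverse)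
  then show ?thesis by presburger
qed

locale base_graph =
  fixes V :: "'v::countable set" and E :: "'v rel"
  assumes finite_V: "finite V" and E_sub: "E \<subseteq> V \<times> V" and sym_E: "sym E" and irrefl_E: "irrefl E"
begin

text \<open>
  An edge at \<open>v\<close> is identified with its other end. The fiber over \<open>v\<close> consists of the sets of
  edges at \<open>v\<close> whose parity is odd exactly for the twisted vertices \<open>v \<in> U\<close>.
\<close>

definition cfi :: "'v set \<Rightarrow> nat pair_pre_digraph" where
  "cfi U = (let X = {encode_vertex v S | v S. v \<in> V \<and> S \<subseteq> E `` {v} \<and> (odd (card S) \<longleftrightarrow> v \<in> U)} in
    \<lparr>pverts = X,
     parcs = {(x, y). x \<in> X \<and> y \<in> X \<and> (base_vertex x, base_vertex y) \<in> E \<and>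
       ((base_vertex y :: 'v) \<in> label x \<longleftrightarrow> (base_vertex x :: 'v) \<in> label y)}\<rparr>)"

abbreviation bv :: "nat \<Rightarrow> 'v" where "bv \<equiv> base_vertex"
abbreviation lb :: "nat \<Rightarrow> 'v set" where "lb \<equiv> label"

lemma finite_E: "finite E"
  using finite_subset[OF E_sub] finite_V by simp

lemma finite_nbs: "finite (E `` A)"
  using finite_Image[OF finite_E] .

lemma finite_subset_nbs: "S \<subseteq> E `` A \<Longrightarrow> finite S"
  using finite_subset finite_nbs by blast

lemma cfi_vertexD:
  assumes "x \<in> pverts (cfi U)"
  shows "bv x \<in> V" "lb x \<subseteq> E `` {bv x}" "odd (card (lb x)) \<longleftrightarrow> bv x \<in> U" "finite (lb x)"
    "encode_vertex (bv x) (lb x) = x"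
  using assms finite_subset_nbs by (auto simp: cfi_def Let_def)

lemma encode_in_cfi_iff:
  assumes "finite S"
  shows "encode_vertex v S \<in> pverts (cfi U) \<longleftrightarrow> v \<in> V \<and> S \<subseteq> E `` {v} \<and> (odd (card S) \<longleftrightarrow> v \<in> U)"
proof
  assume "encode_vertex v S \<in> pverts (cfi U)"
  from cfi_vertexD(1-3)[OF this] show "v \<in> V \<and> S \<subseteq> E `` {v} \<and> (odd (card S) \<longleftrightarrow> v \<in> U)"
    using assms by simp
qed (auto simp: cfi_def Let_def)

lemma cfi_vertex_eqI:
  assumes "x \<in> pverts (cfi U)" "y \<in> pverts (cfi U')" "bv x = bv y" "lb x = lb y"
  shows "x = y"
  using cfi_vertexD(5)[OF assms(1)] cfi_vertexD(5)[OF assms(2)] unfolding assms(3,4) by (rule trans[OF sym])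

lemma cfi_arcs_iff:
  "(x, y) \<in> parcs (cfi U) \<longleftrightarrow> x \<in> pverts (cfi U) \<and> y \<in> pverts (cfi U) \<and> (bv x, bv y) \<in> E \<and>
    (bv y \<in> lb x \<longleftrightarrow> bv x \<in> lb y)"
  by (simp add: cfi_def Let_def)

lemma finite_cfi: "finite (pverts (cfi U))"
proof -
  have "pverts (cfi U) \<subseteq> (\<lambda>(v, S). encode_vertex v S) ` (V \<times> Pow V)"
    using E_sub by (fastforce simp: cfi_def Let_def)
  then show ?thesis using finite_V by (auto intro: finite_subset)
qed

lemma pair_graph_cfi: "pair_graph (cfi U)"
proof
  show "finite (pverts (cfi U))" by (rule finite_cfi)
  show "finite (parcs (cfi U))"
    by (rule finite_subset[of _ "pverts (cfi U) \<times> pverts (cfi U)"]) (auto simp: cfi_arcs_iff finite_cfi)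
  show "symmetric (with_proj (cfi U))"
    unfolding symmetric_def using symD[OF sym_E] by (auto simp: sym_def cfi_arcs_iff)
next
  fix e assume e: "e \<in> parcs (cfi U)"
  then obtain x y where xy: "e = (x, y)" by fastforce
  show "fst e \<in> pverts (cfi U)" "snd e \<in> pverts (cfi U)" "fst e \<noteq> snd e"
    using e irrefl_E unfolding xy by (auto simp: cfi_arcs_iff irrefl_def)
qed

section \<open>Non-isomorphism by counting homomorphisms from the base graph\<close>

definition base_homs :: "'v set \<Rightarrow> ('v \<Rightarrow> nat) set" where
  "base_homs U = {h \<in> V \<rightarrow>\<^sub>E pverts (cfi U). \<forall>a b. (a, b) \<in> E \<longrightarrow> (h a, h b) \<in> parcs (cfi U)}"

lemma finite_base_homs: "finite (base_homs U)"
  unfolding base_homs_def using finite_PiE[OF finite_V finite_cfi] by simp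

lemma base_homs_vertex: "h \<in> base_homs U \<Longrightarrow> a \<in> V \<Longrightarrow> h a \<in> pverts (cfi U)"
  by (auto simp: base_homs_def)

text \<open>Handshaking: the labels of a section would form a graph with exactly one vertex of odd degree.\<close>

lemma no_section_twisted:
  assumes "u \<in> V" and h: "h \<in> base_homs {u}" and sec: "\<And>a. a \<in> V \<Longrightarrow> bv (h a) = a"
  shows False
proof -
  define F where "F = Sigma V (\<lambda>a. lb (h a))"
  note vert = cfi_vertexD[OF base_homs_vertex[OF h]]
  have FE: "F \<subseteq> E" unfolding F_def using vert(2) sec by fastforce
  have swap: "b \<in> lb (h a) \<longleftrightarrow> a \<in> lb (h b)" if "(a, b) \<in> E" for a b
  proof -
    have "(h a, h b) \<in> parcs (cfi {u})" "a \<in> V" "b \<in> V" using h that E_sub by (auto simp: base_homs_def)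
    then show ?thesis using sec by (simp add: cfi_arcs_iff)
  qed
  have "(b, a) \<in> F" if "(a, b) \<in> F" for a b
  proof -
    have "(a, b) \<in> E" using FE that by blast
    then show ?thesis using swap that E_sub unfolding F_def by auto
  qed
  then have "sym F" by (simp add: sym_def)
  moreover have "irrefl F" using irrefl_E FE unfolding irrefl_def by blast
  moreover have "finite F" using finite_subset[OF FE finite_E] .
  ultimately have "even (card F)" by (intro even_card_sym_irrefl)
  moreover have "card F = (\<Sum>a\<in>V. card (lb (h a)))"
    unfolding F_def using finite_V vert(4) by (intro card_SigmaI) auto
  moreover have "{a \<in> V. odd (card (lb (h a)))} = {u}"
    using vert(3) sec assms(1) by auto
  ultimately show False using even_sum_iff[OF finite_V, of "\<lambda>a. card (lb (h a))"] by simp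
qed

text \<open>
  For a fixed projection to the base graph, the lifts to the twisted graph are either absent, as for
  the identity, or form an affine space over the two-element field whose direction space is the set
  of lifts to the untwisted graph. The map \<open>D\<close> subtracts the reference lift \<open>r h\<close>.
\<close>

lemma card_base_homs_less:
  assumes u: "u \<in> V"
  shows "card (base_homs {u}) < card (base_homs {})"
proof -
  \<comment> \<open>The choice sees \<open>h\<close> only through its projection, so all lifts of
    one projection share a reference. The injectivity of \<open>D\<close> rests on this.\<close>
  define r where "r h = (SOME h'. h' \<in> base_homs {u} \<and> (\<forall>a\<in>V. bv (h' a) = bv (h a)))" for h
  have r: "r h \<in> base_homs {u}" "\<And>a. a \<in> V \<Longrightarrow> bv (r h a) = bv (h a)" if "h \<in> base_homs {u}" for h
    using someI[of "\<lambda>h'. h' \<in> base_homs {u} \<and> (\<forall>a\<in>V. bv (h' a) = bv (h a))" h] that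
    unfolding r_def by auto
  define D where "D h = restrict (\<lambda>a. encode_vertex (bv (h a)) (sym_diff (lb (h a)) (lb (r h a)))) V" for h
  have vD: "bv (D h a) = bv (h a)" "lb (D h a) = sym_diff (lb (h a)) (lb (r h a))"
    "D h a \<in> pverts (cfi {})" if h: "h \<in> base_homs {u}" and a: "a \<in> V" for h a
  proof -
    note ha = cfi_vertexD[OF base_homs_vertex[OF h a]]
    note ra = cfi_vertexD[OF base_homs_vertex[OF r(1)[OF h] a]]
    show "bv (D h a) = bv (h a)" "lb (D h a) = sym_diff (lb (h a)) (lb (r h a))"
      using a ha(4) ra(4) by (simp_all add: D_def)
    have "odd (card (sym_diff (lb (h a)) (lb (r h a)))) \<longleftrightarrow> False"
      using odd_card_sym_diff[OF ha(4) ra(4)] ha(3) ra(3) r(2)[OF h a] by simp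
    then show "D h a \<in> pverts (cfi {})"
      using a ha ra r(2)[OF h a] by (auto simp: D_def encode_in_cfi_iff)
  qed
  have DH: "D h \<in> base_homs {}" if h: "h \<in> base_homs {u}" for h
  proof -
    have "(D h a, D h b) \<in> parcs (cfi {})" if ab: "(a, b) \<in> E" for a b
    proof -
      have V: "a \<in> V" "b \<in> V" using ab E_sub by auto
      have "(h a, h b) \<in> parcs (cfi {u})" "(r h a, r h b) \<in> parcs (cfi {u})"
        using h r(1)[OF h] ab by (auto simp: base_homs_def)
      then show ?thesis
        unfolding cfi_arcs_iff using vD[OF h V(1)] vD[OF h V(2)] r(2)[OF h V(1)] r(2)[OF h V(2)] by auto
    qed
    moreover have "D h \<in> V \<rightarrow>\<^sub>E pverts (cfi {})"
      using vD(3)[OF h] by (auto simp: D_def)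
    ultimately show ?thesis by (simp add: base_homs_def)
  qed
  have inj: "inj_on D (base_homs {u})"
  proof (rule inj_onI)
    fix h h' assume h: "h \<in> base_homs {u}" "h' \<in> base_homs {u}" "D h = D h'"
    have b: "bv (h a) = bv (h' a)" if "a \<in> V" for a
      using vD(1)[OF h(1) that] vD(1)[OF h(2) that] h(3) by simp
    then have r: "r h = r h'" unfolding r_def by auto
    have "h a = h' a" if a: "a \<in> V" for a
    proof (rule cfi_vertex_eqI[OF base_homs_vertex[OF h(1) a] base_homs_vertex[OF h(2) a] b[OF a]])
      have "sym_diff (lb (h a)) (lb (r h a)) = sym_diff (lb (h' a)) (lb (r h a))"
        using vD(2)[OF h(1) a] vD(2)[OF h(2) a] h(3) r by simp
      then show "lb (h a) = lb (h' a)" by (metis sym_diff_cancel)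
    qed
    then show "h = h'" using h by (intro PiE_ext[of h V _ h']) (auto simp: base_homs_def)
  qed
  \<comment> \<open>The zero section lifts the identity to the untwisted graph. Its preimage under
    \<open>D\<close> would be a section of the twisted graph, so it makes the inequality
    strict.\<close>
  let ?z = "restrict (\<lambda>a. encode_vertex a {}) V"
  have z: "?z \<in> base_homs {}"
    using E_sub by (auto simp: base_homs_def cfi_arcs_iff encode_in_cfi_iff)
  have "?z \<notin> D ` base_homs {u}"
  proof
    assume "?z \<in> D ` base_homs {u}"
    then obtain h where h: "h \<in> base_homs {u}" "D h = ?z" by auto
    have "bv (h a) = a" if "a \<in> V" for a
      using vD(1)[OF h(1) that] h(2) that by simp
    then show False by (rule no_section_twisted[OF u h(1)])
  qed
  then have "D ` base_homs {u} \<subset> base_homs {}" using DH z by blast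
  from psubset_card_mono[OF finite_base_homs this] show ?thesis using card_image[OF inj] by simp
qed

text \<open>Composition with an isomorphism would inject the homomorphisms into the untwisted graph
  into those into the twisted one, against \<open>card_base_homs_less\<close>.\<close>

lemma not_iso_cfi:
  assumes u: "u \<in> V"
  shows "\<not> digraph_iso (with_proj (cfi {})) (with_proj (cfi {u}))"
proof
  assume "digraph_iso (with_proj (cfi {})) (with_proj (cfi {u}))"
  then obtain f where f: "pre_digraph.digraph_isomorphism (with_proj (cfi {})) f"
    and H: "with_proj (cfi {u}) = app_iso f (with_proj (cfi {}))"
    unfolding digraph_iso_def by blast
  let ?i = "iso_verts f"
  have inj: "inj_on ?i (pverts (cfi {}))"
    using f unfolding pre_digraph.digraph_isomorphism_def by simp
  have verts: "pverts (cfi {u}) = ?i ` pverts (cfi {})"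
    using arg_cong[OF H, of verts] by simp
  have arcs: "parcs (cfi {u}) = iso_arcs f ` parcs (cfi {})"
    using arg_cong[OF H, of arcs] by simp
  \<comment> \<open>A digraph isomorphism carries separate maps for vertices, arcs and ends. Here
    arcs are pairs with ends \<open>fst\<close> and \<open>snd\<close> on both sides, which forces
    the arc map to be the vertex map applied to both components.\<close>
  have tail: "iso_tail f = fst" and head: "iso_head f = snd"
    using arg_cong[OF H, of tail] arg_cong[OF H, of head] by simp_all
  have edge: "(?i x, ?i y) \<in> parcs (cfi {u})" if xy: "(x, y) \<in> parcs (cfi {})" for x y
  proof -
    have "?i x = fst (iso_arcs f (x, y))" "?i y = snd (iso_arcs f (x, y))"
      using f xy tail head unfolding pre_digraph.digraph_isomorphism_def by fastforce+
    then have "(?i x, ?i y) = iso_arcs f (x, y)" by simp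
    then show ?thesis using arcs xy by simp
  qed
  define K where "K h = restrict (\<lambda>a. ?i (h a)) V" for h :: "'v \<Rightarrow> nat"
  have "K ` base_homs {} \<subseteq> base_homs {u}"
  proof
    fix h' assume "h' \<in> K ` base_homs {}"
    then obtain h where h: "h \<in> base_homs {}" "h' = K h" by blast
    have "(K h a, K h b) \<in> parcs (cfi {u})" if "(a, b) \<in> E" for a b
    proof -
      have "(h a, h b) \<in> parcs (cfi {})" "a \<in> V" "b \<in> V" using h(1) that E_sub by (auto simp: base_homs_def)
      then show ?thesis using edge by (simp add: K_def)
    qed
    moreover have "K h \<in> V \<rightarrow>\<^sub>E pverts (cfi {u})"
      using base_homs_vertex[OF h(1)] unfolding verts K_def by auto
    ultimately show "h' \<in> base_homs {u}" using h(2) by (simp add: base_homs_def)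
  qed
  moreover have "inj_on K (base_homs {})"
  proof (rule inj_onI)
    fix h h' assume h: "h \<in> base_homs {}" "h' \<in> base_homs {}" "K h = K h'"
    have "h a = h' a" if a: "a \<in> V" for a
    proof (rule inj_onD[OF inj _ base_homs_vertex[OF h(1) a] base_homs_vertex[OF h(2) a]])
      show "?i (h a) = ?i (h' a)" using fun_cong[OF h(3), of a] a by (simp add: K_def)
    qed
    then show "h = h'" using h by (intro PiE_ext[of h V _ h']) (auto simp: base_homs_def)
  qed
  ultimately have "card (base_homs {}) \<le> card (base_homs {u})"
    by (intro card_inj_on_le[of K] finite_base_homs)
  then show False using card_base_homs_less[OF u] by simp
qed

lemma card_cfi:
  assumes "\<And>v. v \<in> V \<Longrightarrow> card (E `` {v}) \<le> b"
  shows "card (pverts (cfi U)) \<le> card V * 2 ^ b"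
proof -
  have "pverts (cfi U) \<subseteq> (\<Union>v\<in>V. encode_vertex v ` Pow (E `` {v}))"
    by (auto simp: cfi_def Let_def)
  then have "card (pverts (cfi U)) \<le> card (\<Union>v\<in>V. encode_vertex v ` Pow (E `` {v}))"
    by (rule card_mono[rotated]) (simp add: finite_V finite_nbs)
  also have "\<dots> \<le> (\<Sum>v\<in>V. card (encode_vertex v ` Pow (E `` {v})))"
    by (rule card_UN_le[OF finite_V])
  also have "\<dots> \<le> (\<Sum>v\<in>V. 2 ^ b)"
  proof (rule sum_mono)
    fix v assume v: "v \<in> V"
    have "card (encode_vertex v ` Pow (E `` {v})) \<le> card (Pow (E `` {v}))"
      by (rule card_image_le) (simp add: finite_nbs)
    also have "\<dots> \<le> 2 ^ b" using assms[OF v] by (simp add: card_Pow finite_nbs power_increasing)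
    finally show "card (encode_vertex v ` Pow (E `` {v})) \<le> 2 ^ b" .
  qed
  finally show ?thesis by simp
qed

end

section \<open>Weisfeiler-Leman equivalence\<close>

text \<open>\<open>R\<close> acts as a set of winning positions for Duplicator in the bijective
  pebble game. In \<open>step\<close> she commits to a bijection \<open>p\<close> before
  \<open>w\<close> and the position \<open>j\<close> are chosen; \<open>p\<close> then matches the
  two multisets of the refinement element by element.\<close>

lemma wl_coloring_eqI:
  assumes fin: "finite (pverts G)"
    and atp: "\<And>vs ws. R vs ws \<Longrightarrow> atp G vs = atp H ws"
    and len: "\<And>vs ws. R vs ws \<Longrightarrow> length vs = length ws"
    and step: "\<And>vs ws. R vs ws \<Longrightarrow> \<exists>p. bij_betw p (pverts G) (pverts H) \<and>
      (\<forall>w\<in>pverts G. atp G (vs @ [w]) = atp H (ws @ [p w]) \<and>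
        (\<forall>j<length vs. R (vs[j := w]) (ws[j := p w])))"
  shows "R vs ws \<Longrightarrow> wl_coloring G i vs = wl_coloring H i ws"
proof (induction i arbitrary: vs ws)
  case 0
  then show ?case using atp by simp
next
  case (Suc i)
  from step[OF Suc.prems] obtain p where p: "bij_betw p (pverts G) (pverts H)"
    and pw: "\<And>w. w \<in> pverts G \<Longrightarrow> atp G (vs @ [w]) = atp H (ws @ [p w])"
      "\<And>w j. w \<in> pverts G \<Longrightarrow> j < length vs \<Longrightarrow> R (vs[j := w]) (ws[j := p w])"
    by blast
  have H: "mset_set (pverts H) = image_mset p (mset_set (pverts G))"
    using p by (simp add: bij_betw_def image_mset_mset_set)
  have "{# (atp G (vs @ [w]), map (\<lambda>j. wl_coloring G i (vs[j := w])) [0..<length vs]).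
          w \<in># mset_set (pverts G) #} =
        {# (atp H (ws @ [w]), map (\<lambda>j. wl_coloring H i (ws[j := w])) [0..<length ws]).
          w \<in># mset_set (pverts H) #}"
    unfolding H multiset.map_comp
  proof (rule image_mset_cong)
    fix w assume "w \<in># mset_set (pverts G)"
    then have w: "w \<in> pverts G" using fin by simp
    have "map (\<lambda>j. wl_coloring G i (vs[j := w])) [0..<length vs] =
        map (\<lambda>j. wl_coloring H i (ws[j := p w])) [0..<length ws]"
      unfolding len[OF Suc.prems, symmetric]
      by (rule map_cong[OF refl]) (use w pw(2) Suc.IH in simp)
    then show "(atp G (vs @ [w]), map (\<lambda>j. wl_coloring G i (vs[j := w])) [0..<length vs]) =
        ((\<lambda>w. (atp H (ws @ [w]), map (\<lambda>j. wl_coloring H i (ws[j := w])) [0..<length ws])) \<circ> p) w"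
      using pw(1)[OF w] by simp
  qed
  then show ?case using Suc.IH[OF Suc.prems] by simp
qed

text \<open>A bijection \<open>f\<close> inside \<open>R\<close> preserves colors in every round, in
  particular in the stable one, and hence matches the color classes.\<close>

lemma not_wl_distinguishesI:
  assumes fin: "finite (pverts G)"
    and atp: "\<And>vs ws. R vs ws \<Longrightarrow> atp G vs = atp H ws"
    and len: "\<And>vs ws. R vs ws \<Longrightarrow> length vs = length ws"
    and step: "\<And>vs ws. R vs ws \<Longrightarrow> \<exists>p. bij_betw p (pverts G) (pverts H) \<and>
      (\<forall>w\<in>pverts G. atp G (vs @ [w]) = atp H (ws @ [p w]) \<and>
        (\<forall>j<length vs. R (vs[j := w]) (ws[j := p w])))"
    and f: "bij_betw f (tuples k G) (tuples k H)" and Rf: "\<And>vs. vs \<in> tuples k G \<Longrightarrow> R vs (f vs)"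
  shows "\<not> wl_distinguishes k G H"
proof -
  have "card {vs \<in> tuples k G. wl_coloring G r vs = c} = card {vs \<in> tuples k H. wl_coloring H r vs = c}"
    for r c
  proof (rule bij_betw_same_card[of f])
    have eq: "wl_coloring G r vs = wl_coloring H r (f vs)" if "vs \<in> tuples k G" for vs
      by (rule wl_coloring_eqI[of G R]) (fact fin atp len step Rf[OF that])+
    have "f ` {vs \<in> tuples k G. wl_coloring G r vs = c} = {vs \<in> tuples k H. wl_coloring H r vs = c}"
      using eq bij_betw_imp_surj_on[OF f] by (auto simp: image_iff) (metis imageE)
    then show "bij_betw f {vs \<in> tuples k G. wl_coloring G r vs = c} {vs \<in> tuples k H. wl_coloring H r vs = c}"
      using inj_on_subset[OF bij_betw_imp_inj_on[OF f]] by (auto simp: bij_betw_def)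
  qed
  then show ?thesis unfolding wl_distinguishes_def Let_def by simp
qed

section \<open>Moving the twist along sets of base edges\<close>

context base_graph
begin

text \<open>A path between \<open>q\<close> and \<open>q'\<close> avoiding \<open>T\<close>, taken
  modulo 2: all that matters about it is that its degrees are odd exactly at the two ends. With this
  form concatenation is symmetric difference, and no simple path has to be extracted from a
  walk.\<close>

definition linked :: "'v set \<Rightarrow> 'v \<Rightarrow> 'v \<Rightarrow> bool" where
  "linked T q q' \<longleftrightarrow> (\<exists>F\<subseteq>E. sym F \<and> F `` T = {} \<and>
    (\<forall>v. odd (card (F `` {v})) \<longleftrightarrow> (v = q) \<noteq> (v = q')))"

definition flip :: "'v rel \<Rightarrow> nat \<Rightarrow> nat" where
  "flip F x = encode_vertex (bv x) (sym_diff (lb x) (F `` {bv x}))"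

lemma finite_Image_sub: "F \<subseteq> E \<Longrightarrow> finite (F `` A)"
  using finite_Image[OF finite_subset[OF _ finite_E]] .

lemma bv_flip [simp]: "bv (flip F x) = bv x"
  by (simp add: flip_def)

lemma lb_flip: "x \<in> pverts (cfi U) \<Longrightarrow> F \<subseteq> E \<Longrightarrow> lb (flip F x) = sym_diff (lb x) (F `` {bv x})"
  unfolding flip_def using cfi_vertexD(4) finite_Image_sub by simp

lemma flip_flip: "x \<in> pverts (cfi U) \<Longrightarrow> F \<subseteq> E \<Longrightarrow> flip F (flip F x) = x"
  unfolding flip_def[of F "flip F x"] by (simp only: lb_flip bv_flip sym_diff_cancel cfi_vertexD(5))

text \<open>The label at a vertex changes parity exactly when \<open>F\<close> has odd degree there,
  so the twisted set changes by the odd vertices of \<open>F\<close>.\<close>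

lemma flip_in_cfi:
  assumes x: "x \<in> pverts (cfi U)" and F: "F \<subseteq> E"
    and odd: "odd (card (F `` {bv x})) \<longleftrightarrow> (bv x \<in> U) \<noteq> (bv x \<in> U')"
  shows "flip F x \<in> pverts (cfi U')"
proof -
  note xD = cfi_vertexD[OF x]
  have fin: "finite (F `` {bv x})" by (rule finite_Image_sub[OF F])
  have "odd (card (sym_diff (lb x) (F `` {bv x}))) \<longleftrightarrow> bv x \<in> U'"
    unfolding odd_card_sym_diff[OF xD(4) fin] xD(3) odd by auto
  moreover have "sym_diff (lb x) (F `` {bv x}) \<subseteq> E `` {bv x}" using xD(2) F by auto
  moreover have "finite (sym_diff (lb x) (F `` {bv x}))" using xD(4) fin by simp
  ultimately show ?thesis unfolding flip_def using xD(1) by (simp add: encode_in_cfi_iff)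
qed

text \<open>As \<open>F\<close> is symmetric, an edge of \<open>F\<close> negates both sides of the
  adjacency condition, and every other edge leaves both alone.\<close>

lemma flip_arcs_iff:
  assumes F: "F \<subseteq> E" "sym F" and x: "x \<in> pverts (cfi U)" "flip F x \<in> pverts (cfi U')"
    and y: "y \<in> pverts (cfi U)" "flip F y \<in> pverts (cfi U')"
  shows "(flip F x, flip F y) \<in> parcs (cfi U') \<longleftrightarrow> (x, y) \<in> parcs (cfi U)"
proof -
  have "bv y \<in> F `` {bv x} \<longleftrightarrow> bv x \<in> F `` {bv y}"
    using symD[OF F(2)] by auto
  then show ?thesis
    unfolding cfi_arcs_iff bv_flip lb_flip[OF x(1) F(1)] lb_flip[OF y(1) F(1)]
    using x y by blast
qed

lemma atp_map_flip:
  assumes F: "F \<subseteq> E" "sym F"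
    and vs: "\<And>x. x \<in> set vs \<Longrightarrow> x \<in> pverts (cfi U) \<and> flip F x \<in> pverts (cfi U')"
  shows "atp (cfi U) vs = atp (cfi U') (map (flip F) vs)"
proof -
  have "flip F x = flip F y \<longleftrightarrow> x = y" if "x \<in> set vs" "y \<in> set vs" for x y
    using flip_flip[OF _ F(1)] vs[OF that(1)] vs[OF that(2)] by metis
  moreover have "(flip F x, flip F y) \<in> parcs (cfi U') \<longleftrightarrow> (x, y) \<in> parcs (cfi U)"
    if "x \<in> set vs" "y \<in> set vs" for x y
    using flip_arcs_iff[OF F] vs[OF that(1)] vs[OF that(2)] by blast
  ultimately show ?thesis unfolding atp_def by (auto simp: nth_mem)
qed

lemma linked_refl: "linked T q q"
  unfolding linked_def by (rule exI[of _ "{}"]) (simp add: sym_def)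

lemma linked_sym: "linked T q q' \<Longrightarrow> linked T q' q"
proof -
  have "((v = q) \<noteq> (v = q')) = ((v = q') \<noteq> (v = q))" for v by blast
  then show "linked T q q' \<Longrightarrow> linked T q' q" unfolding linked_def by simp
qed

lemma linked_trans:
  assumes "linked T p q" "linked T q r"
  shows "linked T p r"
proof -
  obtain F where F: "F \<subseteq> E" "sym F" "F `` T = {}" "\<And>v. odd (card (F `` {v})) \<longleftrightarrow> (v = p) \<noteq> (v = q)"
    using assms(1) unfolding linked_def by blast
  obtain P where P: "P \<subseteq> E" "sym P" "P `` T = {}" "\<And>v. odd (card (P `` {v})) \<longleftrightarrow> (v = q) \<noteq> (v = r)"
    using assms(2) unfolding linked_def by blast
  have "odd (card (sym_diff F P `` {v})) \<longleftrightarrow> (v = p) \<noteq> (v = r)" for v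
    unfolding sym_diff_Image odd_card_sym_diff[OF finite_Image_sub[OF F(1)] finite_Image_sub[OF P(1)]]
      F(4) P(4) by blast
  moreover have "sym_diff F P \<subseteq> E" "sym_diff F P `` T = {}" using F P by blast+
  ultimately show ?thesis unfolding linked_def using sym_sym_diff[OF F(2) P(2)] by blast
qed

lemma linked_edge:
  assumes "(v, w) \<in> E" "v \<notin> T" "w \<notin> T"
  shows "linked T v w"
proof -
  have "v \<noteq> w" using assms(1) irrefl_E by (auto simp: irrefl_def)
  moreover have "{(v, w), (w, v)} `` {x} = (if x = v then {w} else if x = w then {v} else {})" for x
    using \<open>v \<noteq> w\<close> by auto
  ultimately show ?thesis
    unfolding linked_def using assms symD[OF sym_E assms(1)]
    by (intro exI[of _ "{(v, w), (w, v)}"]) (auto simp: sym_def)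
qed

end

text \<open>A monotone haven, as for an escaping robber in the cops-and-robber game, with
  \<open>linked\<close> in the role of connectedness. The bound is \<open>Suc k\<close> because a
  refinement step looks at one further vertex besides the \<open>k\<close> entries of the
  tuple.\<close>

locale haven_graph = base_graph V E for V :: "'v::countable set" and E +
  fixes k :: nat and haven :: "'v set \<Rightarrow> 'v set"
  assumes haven_sub: "T \<subseteq> V \<Longrightarrow> card T \<le> Suc k \<Longrightarrow> haven T \<subseteq> V - T"
    and haven_nonempty: "T \<subseteq> V \<Longrightarrow> card T \<le> Suc k \<Longrightarrow> haven T \<noteq> {}"
    and haven_antimono: "T \<subseteq> T' \<Longrightarrow> T' \<subseteq> V \<Longrightarrow> card T' \<le> Suc k \<Longrightarrow> haven T' \<subseteq> haven T"
    and haven_linked: "T \<subseteq> V \<Longrightarrow> card T \<le> Suc k \<Longrightarrow> q \<in> haven T \<Longrightarrow> q' \<in> haven T \<Longrightarrow> linked T q q'"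
begin

text \<open>Twisting along \<open>F\<close> moves the defect from \<open>u\<close> to \<open>q\<close>, out of sight of the pebbles on \<open>T\<close>.\<close>

definition hides :: "'v \<Rightarrow> 'v rel \<Rightarrow> 'v \<Rightarrow> 'v set \<Rightarrow> bool" where
  "hides u F q T \<longleftrightarrow> F \<subseteq> E \<and> sym F \<and> q \<in> haven T \<and>
    (\<forall>v. odd (card (F `` {v})) \<longleftrightarrow> (v = u) \<noteq> (v = q))"

text \<open>By monotonicity the hiding place for \<open>T\<close> also lies in
  \<open>haven {}\<close>, where everything is linked to \<open>u\<close>.\<close>

lemma hides_exists:
  assumes u: "u \<in> haven {}" and T: "T \<subseteq> V" "card T \<le> Suc k"
  shows "\<exists>F q. hides u F q T"
proof -
  obtain q where q: "q \<in> haven T" using haven_nonempty[OF T] by blast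
  then have "q \<in> haven {}" using haven_antimono[of "{}" T] T by blast
  then have "linked {} u q" using haven_linked[of "{}"] u by simp
  then show ?thesis unfolding linked_def hides_def using q by blast
qed

text \<open>The new hiding place \<open>q'\<close> still lies in \<open>haven T\<close>, so some
  \<open>P\<close> moves the defect there from \<open>q\<close> while avoiding \<open>T\<close>.
  \<open>P\<close> may run through the new vertices of \<open>T'\<close>; hence only the flips over
  \<open>T\<close> are preserved.\<close>

lemma hides_extend:
  assumes F: "hides u F q T" and T: "T \<subseteq> T'" "T' \<subseteq> V" "card T' \<le> Suc k"
  shows "\<exists>F' q'. hides u F' q' T' \<and> (\<forall>v\<in>T. F' `` {v} = F `` {v})"
proof -
  obtain q' where q': "q' \<in> haven T'" using haven_nonempty[OF T(2,3)] by blast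
  have T0: "T \<subseteq> V" "card T \<le> Suc k"
    using T card_mono[OF finite_subset[OF T(2) finite_V] T(1)] by auto
  have FE: "F \<subseteq> E" "sym F" "q \<in> haven T" "\<And>v. odd (card (F `` {v})) \<longleftrightarrow> (v = u) \<noteq> (v = q)"
    using F unfolding hides_def by blast+
  have "q' \<in> haven T" using haven_antimono[OF T] q' by blast
  then have "linked T q q'" by (rule haven_linked[OF T0 FE(3)])
  then obtain P where P: "P \<subseteq> E" "sym P" "P `` T = {}" "\<And>v. odd (card (P `` {v})) \<longleftrightarrow> (v = q) \<noteq> (v = q')"
    unfolding linked_def by blast
  have "sym_diff F P \<subseteq> E" using FE(1) P(1) by blast
  moreover have "odd (card (sym_diff F P `` {v})) \<longleftrightarrow> (v = u) \<noteq> (v = q')" for v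
    unfolding sym_diff_Image odd_card_sym_diff[OF finite_Image_sub[OF FE(1)] finite_Image_sub[OF P(1)]]
      FE(4) P(4) by blast
  ultimately have "hides u (sym_diff F P) q' T'"
    unfolding hides_def using q' sym_sym_diff[OF FE(2) P(2)] by blast
  moreover have "\<forall>v\<in>T. sym_diff F P `` {v} = F `` {v}" using P(3) by blast
  ultimately show ?thesis by blast
qed

text \<open>The hiding place lies outside \<open>T\<close>, so over \<open>T\<close> the flip
  corrects the parity at \<open>u\<close> and nowhere else. Both directions are covered, since the
  inverse of a flip is the same flip.\<close>

lemma flip_in_cfi_hides:
  assumes F: "hides u F q T" and T: "T \<subseteq> V" "card T \<le> Suc k"
    and x: "x \<in> pverts (cfi U)" "bv x \<in> T" and U: "U = {} \<and> U' = {u} \<or> U = {u} \<and> U' = {}"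
  shows "flip F x \<in> pverts (cfi U')"
proof (rule flip_in_cfi[OF x(1)])
  show "F \<subseteq> E" using F by (simp add: hides_def)
  have "bv x \<noteq> q" using F haven_sub[OF T] x(2) unfolding hides_def by blast
  then show "odd (card (F `` {bv x})) \<longleftrightarrow> (bv x \<in> U) \<noteq> (bv x \<in> U')"
    using F U unfolding hides_def by auto
qed

text \<open>Duplicator keeps the second tuple equal to a flip of the first, with the defect hidden
  from all touched fibers. For each base vertex \<open>b\<close> she picks a flip that agrees with
  the current one on the touched fibers and hides from \<open>b\<close> as well, and uses it to
  answer every \<open>w\<close> over \<open>b\<close>.\<close>

lemma not_wl_distinguishes_cfi:
  assumes u: "u \<in> haven {}"
  shows "\<not> wl_distinguishes k (cfi {}) (cfi {u})"
proof -
  let ?G = "cfi {}" and ?H = "cfi {u}"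
  define touched where "touched vs = bv ` set vs" for vs
  have touched_sub: "touched vs \<subseteq> V" if "set vs \<subseteq> pverts (cfi U)" for vs U
    using that cfi_vertexD(1) unfolding touched_def by blast
  have card_touched: "card (touched vs) \<le> length vs" for vs
    unfolding touched_def using card_image_le[of "set vs" bv] card_length[of vs] by simp
  have touched_tuple: "touched vs \<subseteq> V" "card (touched vs) \<le> Suc k" if "vs \<in> tuples k (cfi U)" for vs U
    using that touched_sub[of vs U] card_touched[of vs] by (auto simp: tuples_def)
  have touched_flip: "touched (map (flip F) vs) = touched vs" for F vs
    unfolding touched_def by (simp add: image_image)
  define R where "R vs ws \<longleftrightarrow> vs \<in> tuples k ?G \<and> (\<exists>F q. hides u F q (touched vs) \<and> ws = map (flip F) vs)" for vs ws
  \<comment> \<open>The flip depends on the touched base vertices only, and flips preserve these. So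
    the resulting map between tuples is its own inverse.\<close>
  define F0 where "F0 T = (SOME F. \<exists>q. hides u F q T)" for T
  have F0: "\<exists>q. hides u (F0 T) q T" if "T \<subseteq> V" "card T \<le> Suc k" for T
    unfolding F0_def by (rule someI_ex) (use hides_exists[OF u that] in blast)
  show ?thesis
  proof (rule not_wl_distinguishesI[of ?G R ?H "\<lambda>vs. map (flip (F0 (touched vs))) vs"])
    show "finite (pverts ?G)" by (rule finite_cfi)
  next
    fix vs ws assume "R vs ws"
    then obtain F q where vs: "vs \<in> tuples k ?G" and F: "hides u F q (touched vs)" and ws: "ws = map (flip F) vs"
      unfolding R_def by blast
    show len: "length vs = length ws" using ws by simp
    have FE: "F \<subseteq> E" "sym F" using F by (auto simp: hides_def)
    have vsG: "x \<in> pverts ?G" if "x \<in> set vs" for x using vs that by (auto simp: tuples_def)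
    have flipH: "flip F x \<in> pverts ?H" if "x \<in> set vs" for x
      by (rule flip_in_cfi_hides[OF F touched_tuple[OF vs] vsG[OF that]]) (auto simp: touched_def that)
    show "atp ?G vs = atp ?H ws"
      unfolding ws by (rule atp_map_flip[OF FE]) (use vsG flipH in blast)
    have lvs: "length vs = k" using vs by (simp add: tuples_def)
    have "\<exists>F'. \<exists>q'. hides u F' q' (insert b (touched vs)) \<and> (\<forall>v\<in>touched vs. F' `` {v} = F `` {v})" if "b \<in> V" for b
      by (rule hides_extend[OF F])
        (use that touched_tuple[OF vs] card_touched[of vs] lvs card_insert_le_m1[of "Suc k" "touched vs" b] in auto)
    then have "\<forall>b\<in>V. \<exists>F'. \<exists>q'. hides u F' q' (insert b (touched vs)) \<and> (\<forall>v\<in>touched vs. F' `` {v} = F `` {v})"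
      by (rule ballI)
    from bchoice[OF this] obtain F' where F': "\<And>b. b \<in> V \<Longrightarrow> \<exists>q'. hides u (F' b) q' (insert b (touched vs))"
      "\<And>b v. b \<in> V \<Longrightarrow> v \<in> touched vs \<Longrightarrow> F' b `` {v} = F `` {v}"
      by auto
    have F'E: "F' b \<subseteq> E" "sym (F' b)" if "b \<in> V" for b
      using F'(1)[OF that] by (auto simp: hides_def)
    have T': "insert b (touched vs) \<subseteq> V" "card (insert b (touched vs)) \<le> Suc k" if "b \<in> V" for b
      using that touched_tuple[OF vs] card_touched[of vs] lvs card_insert_le_m1[of "Suc k" "touched vs" b] by auto
    \<comment> \<open>Each fiber gets its own flip, so \<open>p\<close> need not respect adjacency
      between fibers. It is a bijection since it stays within fibers, and only the single flip
      belonging to \<open>w\<close> is compared with the tuple.\<close>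
    define p where "p w = flip (F' (bv w)) w" for w
    have p_in: "p w \<in> pverts (cfi U')" if "w \<in> pverts (cfi U)" "U = {} \<and> U' = {u} \<or> U = {u} \<and> U' = {}" for w U U'
    proof -
      have b: "bv w \<in> V" using cfi_vertexD(1)[OF that(1)] .
      obtain q' where "hides u (F' (bv w)) q' (insert (bv w) (touched vs))" using F'(1)[OF b] by blast
      then show ?thesis unfolding p_def
        by (rule flip_in_cfi_hides[OF _ T'[OF b] that(1) _ that(2)]) simp
    qed
    have pp: "p (p w) = w" if "w \<in> pverts (cfi U)" for w U
      using flip_flip[OF that F'E(1)[OF cfi_vertexD(1)[OF that]]] by (simp add: p_def)
    have pbij: "bij_betw p (pverts ?G) (pverts ?H)"
      by (rule bij_betw_byWitness[of _ p]) (use pp p_in in auto)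
    have same: "flip (F' b) x = flip F x" if "x \<in> set vs" "b \<in> V" for x b
      using F'(2)[OF that(2), of "bv x"] that(1) by (simp add: flip_def touched_def)
    show "\<exists>p. bij_betw p (pverts ?G) (pverts ?H) \<and>
      (\<forall>w\<in>pverts ?G. atp ?G (vs @ [w]) = atp ?H (ws @ [p w]) \<and>
        (\<forall>j<length vs. R (vs[j := w]) (ws[j := p w])))"
    proof (intro exI[of _ p] conjI ballI allI impI pbij)
      fix w assume w: "w \<in> pverts ?G"
      have b: "bv w \<in> V" using cfi_vertexD(1)[OF w] .
      have "ws = map (flip (F' (bv w))) vs" unfolding ws using same[OF _ b] by simp
      then have ws': "ws @ [p w] = map (flip (F' (bv w))) (vs @ [w])"
        and wsj: "ws[j := p w] = map (flip (F' (bv w))) (vs[j := w])" for j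
        by (simp_all add: p_def map_update)
      show "atp ?G (vs @ [w]) = atp ?H (ws @ [p w])"
        unfolding ws'
      proof (rule atp_map_flip[OF F'E[OF b]])
        fix x assume "x \<in> set (vs @ [w])"
        then consider "x \<in> set vs" | "x = w" by auto
        then show "x \<in> pverts ?G \<and> flip (F' (bv w)) x \<in> pverts ?H"
        proof cases
          case 1
          then show ?thesis using vsG flipH same[OF _ b] by simp
        next
          case 2
          then show ?thesis using w p_in[OF w] by (simp add: p_def)
        qed
      qed
      fix j assume "j < length vs"
      have sub: "set (vs[j := w]) \<subseteq> insert w (set vs)" by (rule set_update_subset_insert)
      then have tup: "vs[j := w] \<in> tuples k ?G"
        using vsG w lvs by (auto simp: tuples_def)
      obtain q' where q': "hides u (F' (bv w)) q' (insert (bv w) (touched vs))" using F'(1)[OF b] by blast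
      have "touched (vs[j := w]) \<subseteq> insert (bv w) (touched vs)" using sub by (auto simp: touched_def)
      from haven_antimono[OF this T'[OF b]] q' have "hides u (F' (bv w)) q' (touched (vs[j := w]))"
        unfolding hides_def by blast
      then show "R (vs[j := w]) (ws[j := p w])"
        unfolding R_def wsj using tup by blast
    qed
  next
    let ?f = "\<lambda>vs. map (flip (F0 (touched vs))) vs"
    have in_tuples: "?f vs \<in> tuples k (cfi U')"
      if vs: "vs \<in> tuples k (cfi U)" and U: "U = {} \<and> U' = {u} \<or> U = {u} \<and> U' = {}" for vs U U'
    proof -
      obtain q where q: "hides u (F0 (touched vs)) q (touched vs)" using F0[OF touched_tuple[OF vs]] by blast
      have "flip (F0 (touched vs)) x \<in> pverts (cfi U')" if "x \<in> set vs" for x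
        by (rule flip_in_cfi_hides[OF q touched_tuple[OF vs] _ _ U])
          (use vs that in \<open>auto simp: tuples_def touched_def\<close>)
      then show ?thesis using vs by (auto simp: tuples_def)
    qed
    have ff: "?f (?f vs) = vs" if vs: "vs \<in> tuples k (cfi U)" for vs U
    proof -
      obtain q where q: "hides u (F0 (touched vs)) q (touched vs)" using F0[OF touched_tuple[OF vs]] by blast
      then have "F0 (touched vs) \<subseteq> E" by (simp add: hides_def)
      then have "flip (F0 (touched vs)) (flip (F0 (touched vs)) x) = x" if "x \<in> set vs" for x
        using flip_flip vs that by (auto simp: tuples_def)
      then show ?thesis unfolding touched_flip by (simp add: map_idI)
    qed
    show "bij_betw ?f (tuples k ?G) (tuples k ?H)"
      by (rule bij_betw_byWitness[of _ ?f]) (use ff in_tuples in auto)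
    show "R vs (?f vs)" if "vs \<in> tuples k ?G" for vs
      unfolding R_def using that F0[OF touched_tuple[OF that]] by blast
  qed
qed

end

section \<open>The network and its twin-width\<close>

text \<open>
  Row \<open>r\<close> on level \<open>l\<close> consists of \<open>In l r\<close> and \<open>Out l r\<close>; the subdivided edges \<open>Wire b l r\<close>
  lead from it to the rows \<open>r\<close> and \<open>r + 2 ^ l\<close> modulo \<open>2 ^ d\<close> of the cyclically next level.
  So the row differences of a walk around the levels spell out a binary number, and rows can be
  reduced modulo any smaller power of two.
\<close>

datatype node = In nat int | Out nat int | Wire bool nat int

instance node :: countable
  by countable_datatype

locale network =
  fixes d :: nat
  assumes d_pos: "0 < d"
begin

abbreviation n :: int where "n \<equiv> 2 ^ d"

definition nxt :: "nat \<Rightarrow> nat" where "nxt l = (if Suc l = d then 0 else Suc l)"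
definition prv :: "nat \<Rightarrow> nat" where "prv l = (if l = 0 then d - 1 else l - 1)"
definition off :: "bool \<Rightarrow> nat \<Rightarrow> int" where "off b l = (if b then 2 ^ l else 0)"

primrec lev :: "node \<Rightarrow> nat" where
  "lev (In l r) = l" | "lev (Out l r) = l" | "lev (Wire b l r) = l"

primrec row :: "node \<Rightarrow> int" where
  "row (In l r) = r" | "row (Out l r) = r" | "row (Wire b l r) = r"

definition nodes :: "node set" where
  "nodes = {v. lev v < d \<and> 0 \<le> row v \<and> row v < n}"

fun arc :: "node \<Rightarrow> node \<Rightarrow> bool" where
  "arc (In l r) (Out l' r') \<longleftrightarrow> l' = l \<and> r' = r"
| "arc (Out l r) (Wire b l' r') \<longleftrightarrow> l' = l \<and> r' = r"
| "arc (Wire b l r) (In l' r') \<longleftrightarrow> l' = nxt l \<and> r' = (r + off b l) mod n"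
| "arc _ _ \<longleftrightarrow> False"

definition edges :: "node rel" where
  "edges = {(v, w). v \<in> nodes \<and> w \<in> nodes \<and> (arc v w \<or> arc w v)}"

lemma nxt_less: "l < d \<Longrightarrow> nxt l < d"
  by (auto simp: nxt_def)

lemma prv_nxt: "l < d \<Longrightarrow> prv (nxt l) = l"
  by (auto simp: nxt_def prv_def)

lemma mod_pow_mod: "j \<le> d \<Longrightarrow> (x mod n) mod 2 ^ j = x mod 2 ^ j" for x :: int
  by (rule mod_mod_cancel) (simp add: le_imp_power_dvd)

lemma finite_nodes: "finite nodes"
proof -
  have "nodes \<subseteq> (\<lambda>(l, r). In l r) ` ({..<d} \<times> {0..<n}) \<union> (\<lambda>(l, r). Out l r) ` ({..<d} \<times> {0..<n}) \<union>
    ((\<lambda>(l, r). Wire False l r) ` ({..<d} \<times> {0..<n}) \<union> (\<lambda>(l, r). Wire True l r) ` ({..<d} \<times> {0..<n}))"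
  proof
    fix v assume "v \<in> nodes"
    then show "v \<in> (\<lambda>(l, r). In l r) ` ({..<d} \<times> {0..<n}) \<union> (\<lambda>(l, r). Out l r) ` ({..<d} \<times> {0..<n}) \<union>
      ((\<lambda>(l, r). Wire False l r) ` ({..<d} \<times> {0..<n}) \<union> (\<lambda>(l, r). Wire True l r) ` ({..<d} \<times> {0..<n}))"
      by (cases v) (auto simp: nodes_def image_iff)
  qed
  then show ?thesis by (rule finite_subset) simp
qed

lemma card_nodes: "card nodes \<le> 4 * d * 2 ^ d"
proof -
  let ?K = "{..<d} \<times> {0..<n}"
  let ?f = "\<lambda>(i, l, r). if i = (0::nat) then In l r else if i = 1 then Out l r else
    if i = 2 then Wire False l r else Wire True l r"
  have "nodes \<subseteq> ?f ` ({..<4} \<times> ?K)"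
  proof
    fix v assume v: "v \<in> nodes"
    show "v \<in> ?f ` ({..<4} \<times> ?K)"
    proof (cases v)
      case (In l r)
      then show ?thesis using v by (intro image_eqI[of _ _ "(0, l, r)"]) (auto simp: nodes_def)
    next
      case (Out l r)
      then show ?thesis using v by (intro image_eqI[of _ _ "(1, l, r)"]) (auto simp: nodes_def)
    next
      case (Wire b l r)
      then show ?thesis using v
        by (intro image_eqI[of _ _ "(if b then 3 else 2, l, r)"]) (auto simp: nodes_def)
    qed
  qed
  then have "card nodes \<le> card (?f ` ({..<4} \<times> ?K))" by (rule card_mono[rotated]) simp
  also have "\<dots> \<le> card ({..<4::nat} \<times> ?K)" by (rule card_image_le) simp
  also have "\<dots> = 4 * d * 2 ^ d" by (simp add: card_cartesian_product nat_power_eq)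
  finally show ?thesis .
qed

sublocale base_graph nodes edges
proof
  show "finite nodes" by (rule finite_nodes)
  show "edges \<subseteq> nodes \<times> nodes" "sym edges" by (auto simp: edges_def sym_def)
  have "\<not> arc v v" for v by (cases v) auto
  then show "irrefl edges" by (auto simp: edges_def irrefl_def)
qed

lemma In_edge:
  assumes "(In l r, w) \<in> edges"
  shows "w = Out l r \<or> (\<exists>b. w = Wire b (prv l) ((r - off b (prv l)) mod n))"
proof (cases w)
  case (Wire b l' r')
  with assms have *: "l = nxt l'" "r = (r' + off b l') mod n" "l' < d" "0 \<le> r'" "r' < n"
    by (auto simp: edges_def nodes_def)
  have "(r - off b l') mod n = r' mod n" unfolding *(2) by (simp add: mod_diff_left_eq)
  also have "\<dots> = r'" using * by simp
  finally show ?thesis using Wire * by (simp add: prv_nxt)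
qed (use assms in \<open>auto simp: edges_def\<close>)

lemma Out_edge:
  assumes "(Out l r, w) \<in> edges"
  shows "w = In l r \<or> (\<exists>b. w = Wire b l r)"
  using assms by (cases w) (auto simp: edges_def)

lemma Wire_edge:
  assumes "(Wire b l r, w) \<in> edges"
  shows "w = Out l r \<or> w = In (nxt l) ((r + off b l) mod n)"
  using assms by (cases w) (auto simp: edges_def)

text \<open>As long as parts are unions of fibers, every base edge may be counted as red, and the
  bound becomes one on the colors of neighbors in the base graph.\<close>

lemma contractible_base_coloring:
  fixes f :: "node \<Rightarrow> 'a" and g :: "node \<Rightarrow> 'b"
  assumes g: "contractible 4 (cfi U) (color_partition (pverts (cfi U)) (\<lambda>x. g (bv x)))"
    and fg: "\<And>v w. v \<in> nodes \<Longrightarrow> w \<in> nodes \<Longrightarrow> f v = f w \<Longrightarrow> g v = g w"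
    and nb: "\<And>v. v \<in> nodes \<Longrightarrow> \<exists>a b c e. \<forall>y w. (y, w) \<in> edges \<longrightarrow> g y = g v \<longrightarrow> f w \<in> {a, b, c, e}"
  shows "contractible 4 (cfi U) (color_partition (pverts (cfi U)) (\<lambda>x. f (bv x)))"
proof (rule contractible_coarser_coloring[OF finite_cfi _ g])
  show "g (bv x) = g (bv y)" if "x \<in> pverts (cfi U)" "y \<in> pverts (cfi U)" "f (bv x) = f (bv y)" for x y
    using fg[OF cfi_vertexD(1)[OF that(1)] cfi_vertexD(1)[OF that(2)] that(3)] .
  fix x assume "x \<in> pverts (cfi U)"
  from nb[OF cfi_vertexD(1)[OF this]] obtain a b c e
    where ab: "\<forall>y w. (y, w) \<in> edges \<longrightarrow> g y = g (bv x) \<longrightarrow> f w \<in> {a, b, c, e}"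
    by (elim exE) (rule that)
  show "\<exists>a b c e. \<forall>y w. y \<in> pverts (cfi U) \<longrightarrow> w \<in> pverts (cfi U) \<longrightarrow> g (bv y) = g (bv x) \<longrightarrow>
    (y, w) \<in> parcs (cfi U) \<longrightarrow>
    (\<exists>y' w'. y' \<in> pverts (cfi U) \<and> w' \<in> pverts (cfi U) \<and> g (bv y') = g (bv x) \<and>
      g (bv w') = g (bv w) \<and> (y', w') \<notin> parcs (cfi U)) \<longrightarrow> f (bv w) \<in> {a, b, c, e}"
  proof (rule exI[of _ a], rule exI[of _ b], rule exI[of _ c], rule exI[of _ e], intro allI impI)
    fix y w assume "g (bv y) = g (bv x)" "(y, w) \<in> parcs (cfi U)"
    then show "f (bv w) \<in> {a, b, c, e}"
      using ab[rule_format, of "bv y" "bv w"] by (simp only: cfi_arcs_iff)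
  qed
qed

lemma node_edge_cases [consumes 1, case_names In_Out In_Wire Out_In Out_Wire Wire_Out Wire_In]:
  assumes "(y, w) \<in> edges"
  obtains l r where "y = In l r" "w = Out l r"
  | l r b where "y = In l r" "w = Wire b (prv l) ((r - off b (prv l)) mod n)"
  | l r where "y = Out l r" "w = In l r"
  | l r b where "y = Out l r" "w = Wire b l r"
  | l r b where "y = Wire b l r" "w = Out l r"
  | l r b where "y = Wire b l r" "w = In (nxt l) ((r + off b l) mod n)"
proof (cases y)
  case (In l r)
  then show ?thesis using In_edge[of l r w] assms that by blast
next
  case (Out l r)
  then show ?thesis using Out_edge[of l r w] assms that by blast
next
  case (Wire b l r)
  then show ?thesis using Wire_edge[of b l r w] assms that by blast
qed

text \<open>The color merges all levels up to \<open>d - 1 - j\<close>. The induction starts with a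
  single class and peels off one level at a time from the top, so the quotient remains a
  cycle.\<close>

lemma contractible_levels:
  assumes ne: "pverts (cfi U) \<noteq> {}"
  shows "j < d \<Longrightarrow> contractible 4 (cfi U) (color_partition (pverts (cfi U)) (\<lambda>x. max (lev (bv x)) (d - 1 - j)))"
proof (induction j)
  case 0
  have "max (lev (bv x)) (d - 1 - 0) = d - 1" if "x \<in> pverts (cfi U)" for x
    using cfi_vertexD(1)[OF that] unfolding nodes_def max_def by simp linarith
  then show ?case by (intro contractible_const[OF ne]) simp
next
  case (Suc j)
  define i where "i = d - 1 - Suc j"
  have i: "d - 1 - j = Suc i" "Suc i < d" using Suc.prems unfolding i_def by auto
  show ?case unfolding i_def[symmetric]
  proof (rule contractible_base_coloring[where g = "\<lambda>v. max (lev v) (Suc i)"])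
    show "contractible 4 (cfi U) (color_partition (pverts (cfi U)) (\<lambda>x. max (lev (bv x)) (Suc i)))"
      using Suc i by simp
    show "max (lev v) (Suc i) = max (lev w) (Suc i)" if "max (lev v) i = max (lev w) i" for v w
      using that by linarith
    fix v assume v: "v \<in> nodes"
    show "\<exists>a b c e. \<forall>y w. (y, w) \<in> edges \<longrightarrow> max (lev y) (Suc i) = max (lev v) (Suc i) \<longrightarrow>
      max (lev w) i \<in> {a, b, c, e}"
    proof (cases "lev v \<le> Suc i")
      case True
      \<comment> \<open>The color \<open>d - 1\<close> arises from the wraparound below level
        0.\<close>
      have "max (lev w) i \<in> {i, Suc i, Suc (Suc i), d - 1}"
        if yw: "(y, w) \<in> edges" "max (lev y) (Suc i) = max (lev v) (Suc i)" for y w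
      proof -
        have "lev y \<le> Suc i" using that True by linarith
        moreover have "lev w = lev y \<or> lev w = nxt (lev y) \<or> lev w = prv (lev y)"
          using yw(1) by (cases rule: node_edge_cases) auto
        ultimately show ?thesis using i by (auto simp: nxt_def prv_def max_def split: if_splits)
      qed
      then show ?thesis by blast
    next
      case False
      have "max (lev w) i \<in> {i, lev v - 1, lev v, Suc (lev v)}"
        if yw: "(y, w) \<in> edges" "max (lev y) (Suc i) = max (lev v) (Suc i)" for y w
      proof -
        have "lev y = lev v" using that False by linarith
        moreover have "lev w = lev y \<or> lev w = nxt (lev y) \<or> lev w = prv (lev y)"
          using yw(1) by (cases rule: node_edge_cases) auto
        ultimately show ?thesis using False by (auto simp: nxt_def prv_def max_def split: if_splits)
      qed
      then show ?thesis by blast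
    qed
  qed
qed

primrec is_wire :: "node \<Rightarrow> bool" where
  "is_wire (In l r) = False" | "is_wire (Out l r) = False" | "is_wire (Wire b l r) = True"

primrec kind :: "node \<Rightarrow> nat" where
  "kind (In l r) = 0" | "kind (Out l r) = 1" | "kind (Wire b l r) = 2"

primrec reduce :: "int \<Rightarrow> int \<Rightarrow> node \<Rightarrow> node" where
  "reduce m m' (In l r) = In l (r mod m)"
| "reduce m m' (Out l r) = Out l (r mod m)"
| "reduce m m' (Wire b l r) = Wire b l (r mod m')"

text \<open>Splitting a level into its four classes at once would admit up to seven neighboring
  colors. Separating wires from their ends, then \<open>In\<close> from \<open>Out\<close>, then the
  two sorts of wires keeps to four.\<close>

lemma contractible_one_row:
  assumes ne: "pverts (cfi U) \<noteq> {}"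
  shows "contractible 4 (cfi U) (color_partition (pverts (cfi U)) (\<lambda>x. reduce 1 1 (bv x)))"
proof -
  have "contractible 4 (cfi U) (color_partition (pverts (cfi U)) (\<lambda>x. lev (bv x)))"
    using contractible_levels[OF ne, of "d - 1"] d_pos by simp
  then have "contractible 4 (cfi U) (color_partition (pverts (cfi U)) (\<lambda>x. (\<lambda>v. (lev v, is_wire v)) (bv x)))"
  proof (rule contractible_base_coloring)
    fix v
    have "(lev w, is_wire w) \<in> {(lev v, False), (lev v, True), (nxt (lev v), False), (prv (lev v), True)}"
      if "(y, w) \<in> edges" "lev y = lev v" for y w
      using that by (cases rule: node_edge_cases) auto
    then show "\<exists>a b c e. \<forall>y w. (y, w) \<in> edges \<longrightarrow> lev y = lev v \<longrightarrow> (lev w, is_wire w) \<in> {a, b, c, e}"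
      by blast
  qed simp
  then have "contractible 4 (cfi U) (color_partition (pverts (cfi U)) (\<lambda>x. (\<lambda>v. (lev v, kind v)) (bv x)))"
  proof (rule contractible_base_coloring)
    show "(lev v, is_wire v) = (lev w, is_wire w)" if "(lev v, kind v) = (lev w, kind w)" for v w
      using that by (cases v; cases w) auto
    fix v
    have "(lev w, kind w) \<in> (if is_wire v then {(lev v, 1), (nxt (lev v), 0)}
        else {(lev v, 0), (lev v, 1), (lev v, 2), (prv (lev v), 2)})"
      if "(y, w) \<in> edges" "(lev y, is_wire y) = (lev v, is_wire v)" for y w
      using that by (cases rule: node_edge_cases) auto
    then show "\<exists>a b c e. \<forall>y w. (y, w) \<in> edges \<longrightarrow> (lev y, is_wire y) = (lev v, is_wire v) \<longrightarrow>
      (lev w, kind w) \<in> {a, b, c, e}"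
      by (cases "is_wire v") (simp_all, blast+)
  qed
  then show ?thesis
  proof (rule contractible_base_coloring)
    show "(lev v, kind v) = (lev w, kind w)" if "reduce 1 1 v = reduce 1 1 w" for v w
      using that by (cases v; cases w) auto
    fix v
    have "reduce 1 1 w \<in> (if kind v = 0 then {Out (lev v) 0, Wire False (prv (lev v)) 0, Wire True (prv (lev v)) 0}
        else if kind v = 1 then {In (lev v) 0, Wire False (lev v) 0, Wire True (lev v) 0}
        else {Out (lev v) 0, In (nxt (lev v)) 0})"
      if "(y, w) \<in> edges" "(lev y, kind y) = (lev v, kind v)" for y w
      using that by (cases rule: node_edge_cases) auto
    then show "\<exists>a b c e. \<forall>y w. (y, w) \<in> edges \<longrightarrow> (lev y, kind y) = (lev v, kind v) \<longrightarrow>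
      reduce 1 1 w \<in> {a, b, c, e}"
      by (cases "kind v = 0"; cases "kind v = 1") (simp_all, blast+)
  qed
qed

lemma mod_pow_Suc_cases:
  fixes a b :: int
  assumes "a mod 2 ^ j = b mod 2 ^ j"
  shows "a mod 2 ^ Suc j \<in> {b mod 2 ^ j, b mod 2 ^ j + 2 ^ j}"
proof -
  have "a mod 2 ^ Suc j = 2 ^ j * (a div 2 ^ j mod 2) + a mod 2 ^ j"
    using zmod_zmult2_eq[of 2 a "2 ^ j"] by (simp add: mult.commute)
  moreover have "a div 2 ^ j mod 2 = 0 \<or> a div 2 ^ j mod 2 = 1" by presburger
  ultimately show ?thesis using assms by auto
qed

text \<open>Doubling the modulus for all nodes at once would give an \<open>In\<close> or
  \<open>Out\<close> class six neighboring colors: two opposite ends and four wires. The ends are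
  refined first, while the coarse wires account for just two colors; when the wires follow, they see
  two colors on either side and the ends have only one opposite end left.\<close>

lemma contractible_rows:
  assumes ne: "pverts (cfi U) \<noteq> {}"
  shows "j \<le> d \<Longrightarrow> contractible 4 (cfi U) (color_partition (pverts (cfi U)) (\<lambda>x. reduce (2 ^ j) (2 ^ j) (bv x)))"
proof (induction j)
  case 0
  then show ?case using contractible_one_row[OF ne] by simp
next
  case (Suc j)
  let ?m = "2 ^ j :: int" and ?m' = "2 ^ Suc j :: int"
  have "?m dvd ?m'" by simp
  then have mm: "x mod ?m = y mod ?m" if "x mod ?m' = y mod ?m'" for x y :: int
    using that by (metis mod_mod_cancel)
  have mn: "(x mod n) mod ?m = x mod ?m" "(x mod n) mod ?m' = x mod ?m'" for x :: int
    using Suc.prems mod_pow_mod[of j x] mod_pow_mod[of "Suc j" x] by auto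
  have add: "(x + z) mod ?m = (y + z) mod ?m" "(x - z) mod ?m = (y - z) mod ?m"
    if "x mod ?m = y mod ?m" for x y z :: int
    using that by (metis mod_add_left_eq, metis mod_diff_left_eq)
  have add': "(x + z) mod ?m' = (y + z) mod ?m'" "(x - z) mod ?m' = (y - z) mod ?m'"
    if "x mod ?m' = y mod ?m'" for x y z :: int
    using that by (metis mod_add_left_eq, metis mod_diff_left_eq)
  have "contractible 4 (cfi U) (color_partition (pverts (cfi U)) (\<lambda>x. reduce ?m ?m (bv x)))"
    using Suc by simp
  then have "contractible 4 (cfi U) (color_partition (pverts (cfi U)) (\<lambda>x. reduce ?m' ?m (bv x)))"
  proof (rule contractible_base_coloring)
    show "reduce ?m ?m v = reduce ?m ?m w" if "reduce ?m' ?m v = reduce ?m' ?m w" for v w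
      using that by (cases v; cases w) (auto intro: mm)
    fix v
    show "\<exists>a b c e. \<forall>y w. (y, w) \<in> edges \<longrightarrow> reduce ?m ?m y = reduce ?m ?m v \<longrightarrow>
      reduce ?m' ?m w \<in> {a, b, c, e}"
    proof (cases v)
      case (In l r)
      have "reduce ?m' ?m w \<in> {Out l (r mod ?m), Out l (r mod ?m + ?m),
        Wire False (prv l) ((r - off False (prv l)) mod ?m), Wire True (prv l) ((r - off True (prv l)) mod ?m)}"
        if "(y, w) \<in> edges" "reduce ?m ?m y = reduce ?m ?m v" for y w
        using that(1)
      proof (cases rule: node_edge_cases)
        case (In_Out l' r')
        then show ?thesis using that(2) In mod_pow_Suc_cases[of r' j r] by auto
      next
        case (In_Wire l' r' b)
        then show ?thesis using that(2) In add(2)[of r' r "off b (prv l)"] by (cases b) (auto simp: mn)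
      qed (use that(2) In in auto)
      then show ?thesis by blast
    next
      case (Out l r)
      have "reduce ?m' ?m w \<in> {In l (r mod ?m), In l (r mod ?m + ?m), Wire False l (r mod ?m), Wire True l (r mod ?m)}"
        if "(y, w) \<in> edges" "reduce ?m ?m y = reduce ?m ?m v" for y w
        using that(1)
      proof (cases rule: node_edge_cases)
        case (Out_In l' r')
        then show ?thesis using that(2) Out mod_pow_Suc_cases[of r' j r] by auto
      next
        case (Out_Wire l' r' b)
        then show ?thesis using that(2) Out by (cases b) auto
      qed (use that(2) Out in auto)
      then show ?thesis by blast
    next
      case (Wire b l r)
      have "reduce ?m' ?m w \<in> {Out l (r mod ?m), Out l (r mod ?m + ?m),
        In (nxt l) ((r + off b l) mod ?m), In (nxt l) ((r + off b l) mod ?m + ?m)}"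
        if "(y, w) \<in> edges" "reduce ?m ?m y = reduce ?m ?m v" for y w
        using that(1)
      proof (cases rule: node_edge_cases)
        case (Wire_Out l' r' b')
        then show ?thesis using that(2) Wire mod_pow_Suc_cases[of r' j r] by auto
      next
        case (Wire_In l' r' b')
        then have *: "r' mod ?m = r mod ?m" "l' = l" "b' = b" using that(2) Wire by auto
        show ?thesis using Wire_In * mod_pow_Suc_cases[OF add(1)[OF *(1), of "off b l"]]
          by (simp only: reduce.simps mn) blast
      qed (use that(2) Wire in auto)
      then show ?thesis by blast
    qed
  qed
  then show ?case
  proof (rule contractible_base_coloring)
    show "reduce ?m' ?m v = reduce ?m' ?m w" if "reduce ?m' ?m' v = reduce ?m' ?m' w" for v w
      using that by (cases v; cases w) (auto intro: mm)
    fix v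
    show "\<exists>a b c e. \<forall>y w. (y, w) \<in> edges \<longrightarrow> reduce ?m' ?m y = reduce ?m' ?m v \<longrightarrow>
      reduce ?m' ?m' w \<in> {a, b, c, e}"
    proof (cases v)
      case (In l r)
      have "reduce ?m' ?m' w \<in> {Out l (r mod ?m'), Out l (r mod ?m'),
        Wire False (prv l) ((r - off False (prv l)) mod ?m'), Wire True (prv l) ((r - off True (prv l)) mod ?m')}"
        if "(y, w) \<in> edges" "reduce ?m' ?m y = reduce ?m' ?m v" for y w
        using that(1)
      proof (cases rule: node_edge_cases)
        case (In_Wire l' r' b)
        then show ?thesis using that(2) In add'(2)[of r' r "off b (prv l)"] by (cases b) (auto simp: mn[unfolded power_Suc])
      qed (use that(2) In in auto)
      then show ?thesis by blast
    next
      case (Out l r)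
      have "reduce ?m' ?m' w \<in> {In l (r mod ?m'), In l (r mod ?m'), Wire False l (r mod ?m'), Wire True l (r mod ?m')}"
        if "(y, w) \<in> edges" "reduce ?m' ?m y = reduce ?m' ?m v" for y w
        using that(1)
      proof (cases rule: node_edge_cases)
        case (Out_Wire l' r' b)
        then show ?thesis using that(2) Out by (cases b) auto
      qed (use that(2) Out in auto)
      then show ?thesis by blast
    next
      case (Wire b l r)
      have "reduce ?m' ?m' w \<in> {Out l (r mod ?m), Out l (r mod ?m + ?m),
        In (nxt l) ((r + off b l) mod ?m), In (nxt l) ((r + off b l) mod ?m + ?m)}"
        if "(y, w) \<in> edges" "reduce ?m' ?m y = reduce ?m' ?m v" for y w
        using that(1)
      proof (cases rule: node_edge_cases)
        case (Wire_Out l' r' b')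
        then show ?thesis using that(2) Wire mod_pow_Suc_cases[of r' j r] by auto
      next
        case (Wire_In l' r' b')
        then have *: "r' mod ?m = r mod ?m" "l' = l" "b' = b" using that(2) Wire by auto
        show ?thesis using Wire_In * mod_pow_Suc_cases[OF add(1)[OF *(1), of "off b l"]]
          by (simp only: reduce.simps mn) blast
      qed (use that(2) Wire in auto)
      then show ?thesis by blast
    qed
  qed
qed

end

section \<open>Contracting the fibers\<close>

lemma two_sets_of_parity:
  assumes "a \<notin> A" "b \<notin> A" "a \<noteq> b" "finite Z"
  shows "\<exists>s t. \<forall>S. S \<subseteq> insert a (insert b A) \<longrightarrow> S \<inter> A = Z \<longrightarrow> (odd (card S) \<longleftrightarrow> p) \<longrightarrow> S \<in> {s, t}"
proof -
  have S: "S \<in> (if p = odd (card Z) then {Z, insert a (insert b Z)} else {insert a Z, insert b Z})"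
    if sub: "S \<subseteq> insert a (insert b A)" and Z: "S \<inter> A = Z" and odd: "odd (card S) \<longleftrightarrow> p" for S
  proof -
    have ab: "a \<notin> Z" "b \<notin> Z" using assms Z by auto
    have "S = Z \<union> (S \<inter> {a, b})" using sub Z by auto
    then consider "S = Z" | "S = insert a Z" | "S = insert b Z" | "S = insert a (insert b Z)"
      by (cases "a \<in> S"; cases "b \<in> S") auto
    then show ?thesis using odd ab assms(3,4) by cases auto
  qed
  show ?thesis
    by (cases "p = odd (card Z)") (use S in \<open>simp, metis\<close>)+
qed

context network
begin

lemma nbs_In: "edges `` {In l r} \<subseteq> {Out l r, Wire False (prv l) ((r - off False (prv l)) mod n),
    Wire True (prv l) ((r - off True (prv l)) mod n)}"
proof
  fix w assume "w \<in> edges `` {In l r}"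
  then have "w = Out l r \<or> (\<exists>b. w = Wire b (prv l) ((r - off b (prv l)) mod n))" using In_edge by blast
  then show "w \<in> {Out l r, Wire False (prv l) ((r - off False (prv l)) mod n),
    Wire True (prv l) ((r - off True (prv l)) mod n)}"
    by (elim disjE exE) (simp, case_tac b, simp_all)
qed

lemma nbs_Out: "edges `` {Out l r} \<subseteq> {In l r, Wire False l r, Wire True l r}"
proof
  fix w assume "w \<in> edges `` {Out l r}"
  then have "w = In l r \<or> (\<exists>b. w = Wire b l r)" using Out_edge by blast
  then show "w \<in> {In l r, Wire False l r, Wire True l r}"
    by (elim disjE exE) (simp, case_tac b, simp_all)
qed

lemma nbs_Wire: "edges `` {Wire b l r} \<subseteq> {Out l r, In (nxt l) ((r + off b l) mod n)}"
  using Wire_edge by blast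

text \<open>Once the label is prescribed on \<open>A\<close>, only the edges to \<open>a\<close> and
  \<open>b\<close> are free, and parity makes one of them determine the other.\<close>

lemma two_vertices:
  assumes nbs: "edges `` {v} \<subseteq> insert a (insert b A)" and ab: "a \<notin> A" "b \<notin> A" "a \<noteq> b" "finite Z"
  shows "\<exists>s t. \<forall>w\<in>pverts (cfi U). bv w = v \<longrightarrow> lb w \<inter> A = Z \<longrightarrow> w \<in> {s, t}"
proof -
  obtain s t where st: "\<forall>S. S \<subseteq> insert a (insert b A) \<longrightarrow> S \<inter> A = Z \<longrightarrow> (odd (card S) \<longleftrightarrow> v \<in> U) \<longrightarrow> S \<in> {s, t}"
    using two_sets_of_parity[OF ab, where p = "v \<in> U"] by (elim exE) (rule that)
  have "w \<in> {encode_vertex v s, encode_vertex v t}"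
    if w: "w \<in> pverts (cfi U)" "bv w = v" "lb w \<inter> A = Z" for w
  proof -
    note wD = cfi_vertexD[OF w(1), unfolded w(2)]
    have "lb w \<in> {s, t}" using st wD(2,3) nbs w(3) by blast
    then show ?thesis using wD(5) by auto
  qed
  then show ?thesis by blast
qed

lemma two_wire_vertices: "\<exists>s t. \<forall>w\<in>pverts (cfi U). bv w = Wire b l r \<longrightarrow> w \<in> {s, t}"
  using two_vertices[of "Wire b l r" "Out l r" "In (nxt l) ((r + off b l) mod n)" "{}" "{}" U] nbs_Wire
  by simp

text \<open>Adjacency to \<open>x\<close> prescribes whether the edge to the wire belongs to the
  label of \<open>w\<close>; the fiber over \<open>v\<close> has two further edges, tied together by
  parity.\<close>

lemma two_vertices_beside_wire:
  assumes "bv x = Wire b l r" "x \<in> pverts (cfi U)"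
  shows "\<exists>s t. \<forall>w. (x, w) \<in> parcs (cfi U) \<longrightarrow> bv w = v \<longrightarrow> w \<in> {s, t}"
proof (cases "(Wire b l r, v) \<in> edges")
  case True
  let ?w = "Wire b l r"
  have wv: "?w \<in> edges `` {v}" using True symD[OF sym_E] by blast
  have "\<exists>p q. edges `` {v} \<subseteq> insert p (insert q {?w}) \<and> p \<noteq> ?w \<and> q \<noteq> ?w \<and> p \<noteq> q"
  proof (cases v)
    case (In l' r')
    let ?W = "\<lambda>b. Wire b (prv l') ((r' - off b (prv l')) mod n)"
    have "?w = ?W b" using In_edge[of l' r' ?w] wv unfolding In by auto
    then show ?thesis using nbs_In[of l' r'] unfolding In
      by (intro exI[of _ "Out l' r'"] exI[of _ "?W (\<not> b)"]) (cases b; auto)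
  next
    case (Out l' r')
    have "?w = Wire b l' r'" using Out_edge[of l' r' ?w] wv unfolding Out by auto
    then show ?thesis using nbs_Out[of l' r'] unfolding Out
      by (intro exI[of _ "In l' r'"] exI[of _ "Wire (\<not> b) l' r'"]) (cases b; auto)
  next
    case (Wire b' l' r')
    then show ?thesis using wv by (auto simp: edges_def)
  qed
  then obtain p q where pq: "edges `` {v} \<subseteq> insert p (insert q {?w})" "p \<noteq> ?w" "q \<noteq> ?w" "p \<noteq> q"
    by (elim exE conjE)
  have "\<exists>s t. \<forall>w\<in>pverts (cfi U). bv w = v \<longrightarrow> lb w \<inter> {?w} = (if v \<in> lb x then {?w} else {}) \<longrightarrow> w \<in> {s, t}"
    by (rule two_vertices[OF pq(1)]) (simp_all add: pq(2-4))
  then obtain s t where st: "\<forall>w\<in>pverts (cfi U). bv w = v \<longrightarrow>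
      lb w \<inter> {?w} = (if v \<in> lb x then {?w} else {}) \<longrightarrow> w \<in> {s, t}"
    by (elim exE) (rule that)
  have "w \<in> {s, t}" if w: "(x, w) \<in> parcs (cfi U)" "bv w = v" for w
    using st w unfolding cfi_arcs_iff assms(1) by simp
  then show ?thesis by blast
next
  case False
  have "\<not> ((x, w) \<in> parcs (cfi U) \<and> bv w = v)" for w
    using False assms unfolding cfi_arcs_iff by auto
  then show ?thesis by blast
qed

text \<open>
  The two halves of the fiber over \<open>In l r\<close> or \<open>Out l r\<close> are told apart by the edge between
  these two base vertices. Corresponding halves are completely joined.
\<close>

definition half :: "nat \<Rightarrow> bool" where
  "half x = (case bv x of In l r \<Rightarrow> Out l r \<in> lb x | Out l r \<Rightarrow> In l r \<in> lb x | Wire b l r \<Rightarrow> False)"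

text \<open>Constant over \<open>In\<close> and \<open>Out\<close>: added to \<open>half\<close>, it
  splits the wire fibers into single vertices and leaves the halves intact.\<close>

definition wire_label :: "nat \<Rightarrow> node set" where
  "wire_label x = (case bv x of Wire b l r \<Rightarrow> lb x | _ \<Rightarrow> {})"

lemma half_eq_edge:
  assumes "x \<in> pverts (cfi U)" "y \<in> pverts (cfi U)" "bv x = In l r \<and> bv y = Out l r \<or> bv x = Out l r \<and> bv y = In l r"
  shows "(x, y) \<in> parcs (cfi U) \<longleftrightarrow> half x = half y"
proof -
  have "In l r \<in> nodes \<and> Out l r \<in> nodes"
    using assms cfi_vertexD(1)[OF assms(1)] by (auto simp: nodes_def)
  then have "(bv x, bv y) \<in> edges" using assms(3) by (auto simp: edges_def)
  then show ?thesis using assms unfolding cfi_arcs_iff half_def by auto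
qed

text \<open>A half is completely joined to one half of the opposite end and to nothing in the other,
  so red edges lead only to the two wire fibers. These have at most two vertices each, which gives
  the four.\<close>

lemma half_nonblack_neighbors:
  assumes v: "v = In l r \<or> v = Out l r"
  shows "\<exists>a b c e. \<forall>y w. y \<in> pverts (cfi U) \<longrightarrow> w \<in> pverts (cfi U) \<longrightarrow> (bv y, half y) = (v, h) \<longrightarrow>
      (y, w) \<in> parcs (cfi U) \<longrightarrow>
      (\<exists>y' w'. y' \<in> pverts (cfi U) \<and> w' \<in> pverts (cfi U) \<and> (bv y', half y') = (v, h) \<and>
        (bv w', half w') = (bv w, half w) \<and> (y', w') \<notin> parcs (cfi U)) \<longrightarrow> w \<in> {a, b, c, e}"
proof -
  let ?V = "pverts (cfi U)"
  define v' where "v' = (if v = In l r then Out l r else In l r)"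
  define W where "W b = (if v = In l r then Wire b (prv l) ((r - off b (prv l)) mod n) else Wire b l r)" for b
  have nbs: "edges `` {v} \<subseteq> {v', W False, W True}"
    using v nbs_In[of l r] nbs_Out[of l r] by (auto simp: v'_def W_def simp del: insert_iff Image_singleton_iff)
  have vv': "v = In l r \<and> v' = Out l r \<or> v = Out l r \<and> v' = In l r" using v by (auto simp: v'_def)
  have wires: "\<exists>s t. \<forall>w\<in>?V. bv w = W b \<longrightarrow> w \<in> {s, t}" for b
    unfolding W_def using two_wire_vertices by (cases "v = In l r") (simp_all del: insert_iff)
  obtain a b where ab: "\<forall>w\<in>?V. bv w = W False \<longrightarrow> w \<in> {a, b}" using wires[of False] by (elim exE) (rule that)
  obtain c e where ce: "\<forall>w\<in>?V. bv w = W True \<longrightarrow> w \<in> {c, e}" using wires[of True] by (elim exE) (rule that)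
  have "w \<in> {a, b, c, e}" if y: "y \<in> ?V" and w: "w \<in> ?V" and yv: "(bv y, half y) = (v, h)"
    and yw: "(y, w) \<in> parcs (cfi U)"
    and non: "\<exists>y' w'. y' \<in> ?V \<and> w' \<in> ?V \<and> (bv y', half y') = (v, h) \<and>
      (bv w', half w') = (bv w, half w) \<and> (y', w') \<notin> parcs (cfi U)" for y w
  proof -
    have "bv w \<noteq> v'"
    proof
      assume wv: "bv w = v'"
      obtain y' w' where y'w': "y' \<in> ?V" "w' \<in> ?V" "bv y' = v" "half y' = h" "bv w' = bv w"
        "half w' = half w" "(y', w') \<notin> parcs (cfi U)" using non by auto
      have "half y = half w" using half_eq_edge[OF y w, of l r] yv yw vv' wv by simp
      moreover have "half y' \<noteq> half w'" using half_eq_edge[OF y'w'(1,2), of l r] y'w' vv' wv by simp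
      ultimately show False using y'w' yv by simp
    qed
    moreover have "bv w \<in> edges `` {v}" using yw yv by (simp add: cfi_arcs_iff)
    ultimately have "bv w = W False \<or> bv w = W True" using nbs by blast
    then show ?thesis using ab ce w by blast
  qed
  then show ?thesis by meson
qed

text \<open>In contraction order, each half is merged first, then each wire fiber, and the two
  halves of a fiber last. A single wire vertex sees two vertices in each of its two neighboring
  fibers; a wire fiber sees four halves; a whole \<open>In\<close> or \<open>Out\<close> fiber sees
  two opposite halves and two wire fibers.\<close>

lemma twin_width_cfi:
  assumes ne: "pverts (cfi U) \<noteq> {}"
  shows "twin_width (cfi U) \<le> 4"
proof -
  let ?V = "pverts (cfi U)"
  have "color_partition ?V (\<lambda>x. reduce (2 ^ d) (2 ^ d) (bv x)) = color_partition ?V bv"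
  proof (rule color_partition_cong)
    have "reduce (2 ^ d) (2 ^ d) v = v" if "v \<in> nodes" for v
      using that by (cases v) (auto simp: nodes_def)
    then show "reduce (2 ^ d) (2 ^ d) (bv x) = reduce (2 ^ d) (2 ^ d) (bv y) \<longleftrightarrow> bv x = bv y"
      if "x \<in> ?V" "y \<in> ?V" for x y
      using that[THEN cfi_vertexD(1)] by simp
  qed
  then have "contractible 4 (cfi U) (color_partition ?V bv)"
    using contractible_rows[OF ne order_refl] by simp
  then have "contractible 4 (cfi U) (color_partition ?V (\<lambda>x. (bv x, half x)))"
  proof (rule contractible_coarser_coloring[OF finite_cfi, rotated])
    fix x assume "x \<in> ?V"
    have half_wire: "half w = False" if "bv w = Wire b l r" for w b l r
      using that by (simp add: half_def)
    have "\<exists>a b c e. \<forall>y w. (y, w) \<in> parcs (cfi U) \<longrightarrow> bv y = bv x \<longrightarrow> (bv w, half w) \<in> {a, b, c, e}"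
    proof (cases "bv x")
      case (In l r)
      let ?W = "\<lambda>b. Wire b (prv l) ((r - off b (prv l)) mod n)"
      have "(bv w, half w) \<in> {(Out l r, False), (Out l r, True), (?W False, False), (?W True, False)}"
        if yw: "(y, w) \<in> parcs (cfi U)" "bv y = bv x" for y w
      proof -
        have "bv w \<in> edges `` {In l r}" using yw In by (simp add: cfi_arcs_iff)
        then have "bv w \<in> {Out l r, ?W False, ?W True}" using nbs_In by blast
        then show ?thesis using half_wire[of w] by auto
      qed
      then show ?thesis by blast
    next
      case (Out l r)
      have "(bv w, half w) \<in> {(In l r, False), (In l r, True), (Wire False l r, False), (Wire True l r, False)}"
        if yw: "(y, w) \<in> parcs (cfi U)" "bv y = bv x" for y w
      proof -
        have "bv w \<in> edges `` {Out l r}" using yw Out by (simp add: cfi_arcs_iff)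
        then have "bv w \<in> {In l r, Wire False l r, Wire True l r}" using nbs_Out by blast
        then show ?thesis using half_wire[of w] by auto
      qed
      then show ?thesis by blast
    next
      case (Wire b l r)
      let ?o = "Out l r" and ?i = "In (nxt l) ((r + off b l) mod n)"
      have "(bv w, half w) \<in> {(?o, False), (?o, True), (?i, False), (?i, True)}"
        if yw: "(y, w) \<in> parcs (cfi U)" "bv y = bv x" for y w
      proof -
        have "bv w \<in> edges `` {Wire b l r}" using yw Wire by (simp add: cfi_arcs_iff)
        then have "bv w \<in> {?o, ?i}" using nbs_Wire by blast
        then show ?thesis by auto
      qed
      then show ?thesis by blast
    qed
    then show "\<exists>a b c e. \<forall>y w. y \<in> ?V \<longrightarrow> w \<in> ?V \<longrightarrow> bv y = bv x \<longrightarrow> (y, w) \<in> parcs (cfi U) \<longrightarrow>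
      (\<exists>y' w'. y' \<in> ?V \<and> w' \<in> ?V \<and> bv y' = bv x \<and> bv w' = bv w \<and> (y', w') \<notin> parcs (cfi U)) \<longrightarrow>
      (bv w, half w) \<in> {a, b, c, e}"
      by meson
  qed simp
  then have "contractible 4 (cfi U) (color_partition ?V (\<lambda>x. (bv x, half x, wire_label x)))"
  proof (rule contractible_coarser_coloring[OF finite_cfi, rotated])
    fix x assume x: "x \<in> ?V"
    have wire_label: "wire_label w = {}" if "bv w = Out l r \<or> bv w = In l r" for w l r
      using that by (auto simp: wire_label_def)
    show "\<exists>a b c e. \<forall>y w. y \<in> ?V \<longrightarrow> w \<in> ?V \<longrightarrow> (bv y, half y) = (bv x, half x) \<longrightarrow> (y, w) \<in> parcs (cfi U) \<longrightarrow>
      (\<exists>y' w'. y' \<in> ?V \<and> w' \<in> ?V \<and> (bv y', half y') = (bv x, half x) \<and>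
        (bv w', half w') = (bv w, half w) \<and> (y', w') \<notin> parcs (cfi U)) \<longrightarrow>
      (bv w, half w, wire_label w) \<in> {a, b, c, e}"
    proof (cases "\<exists>b l r. bv x = Wire b l r")
      case True
      then obtain b l r where Wire: "bv x = Wire b l r" by blast
      let ?o = "Out l r" and ?i = "In (nxt l) ((r + off b l) mod n)"
      have "(bv w, half w, wire_label w) \<in> {(?o, False, {}), (?o, True, {}), (?i, False, {}), (?i, True, {})}"
        if yw: "(y, w) \<in> parcs (cfi U)" "(bv y, half y) = (bv x, half x)" for y w
      proof -
        have "bv w \<in> edges `` {Wire b l r}" using yw Wire by (simp add: cfi_arcs_iff)
        then have "bv w \<in> {?o, ?i}" using nbs_Wire by blast
        then show ?thesis using wire_label[of w] by auto
      qed
      then show ?thesis by meson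
    next
      case False
      then have "\<exists>l r. bv x = In l r \<or> bv x = Out l r" by (cases "bv x") auto
      then obtain l r where "bv x = In l r \<or> bv x = Out l r" by blast
      from half_nonblack_neighbors[OF this, of U "half x"] obtain a b c e where
        ab: "\<forall>y w. y \<in> ?V \<longrightarrow> w \<in> ?V \<longrightarrow> (bv y, half y) = (bv x, half x) \<longrightarrow> (y, w) \<in> parcs (cfi U) \<longrightarrow>
      (\<exists>y' w'. y' \<in> ?V \<and> w' \<in> ?V \<and> (bv y', half y') = (bv x, half x) \<and>
        (bv w', half w') = (bv w, half w) \<and> (y', w') \<notin> parcs (cfi U)) \<longrightarrow> w \<in> {a, b, c, e}"
        by (elim exE) (rule that)
      let ?f = "\<lambda>w. (bv w, half w, wire_label w)"
      have img: "?f w \<in> {?f a, ?f b, ?f c, ?f e}" if "w \<in> {a, b, c, e}" for w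
        using that by blast
      show ?thesis
        by (rule exI[of _ "?f a"], rule exI[of _ "?f b"], rule exI[of _ "?f c"], rule exI[of _ "?f e"],
          intro allI impI, rule img, rule ab[rule_format])
    qed
  qed simp
  then have "contractible 4 (cfi U) (color_partition ?V (\<lambda>x. x))"
  proof (rule contractible_coarser_coloring[OF finite_cfi, rotated])
    fix x assume x: "x \<in> ?V"
    show "\<exists>a b c e. \<forall>y w. y \<in> ?V \<longrightarrow> w \<in> ?V \<longrightarrow> (bv y, half y, wire_label y) = (bv x, half x, wire_label x) \<longrightarrow>
      (y, w) \<in> parcs (cfi U) \<longrightarrow>
      (\<exists>y' w'. y' \<in> ?V \<and> w' \<in> ?V \<and> (bv y', half y', wire_label y') = (bv x, half x, wire_label x) \<and>
        (bv w', half w', wire_label w') = (bv w, half w, wire_label w) \<and> (y', w') \<notin> parcs (cfi U)) \<longrightarrow>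
      w \<in> {a, b, c, e}"
    proof (cases "\<exists>b l r. bv x = Wire b l r")
      case True
      then obtain b l r where Wire: "bv x = Wire b l r" by blast
      let ?o = "Out l r" and ?i = "In (nxt l) ((r + off b l) mod n)"
      obtain a a' where a: "\<forall>w. (x, w) \<in> parcs (cfi U) \<longrightarrow> bv w = ?o \<longrightarrow> w \<in> {a, a'}"
        using two_vertices_beside_wire[OF Wire x, of ?o] by (elim exE) (rule that)
      obtain c c' where c: "\<forall>w. (x, w) \<in> parcs (cfi U) \<longrightarrow> bv w = ?i \<longrightarrow> w \<in> {c, c'}"
        using two_vertices_beside_wire[OF Wire x, of ?i] by (elim exE) (rule that)
      have "w \<in> {a, a', c, c'}"
        if y: "y \<in> ?V" "(bv y, half y, wire_label y) = (bv x, half x, wire_label x)" and yw: "(y, w) \<in> parcs (cfi U)" for y w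
      proof -
        have bv: "bv y = bv x" and wl: "wire_label y = wire_label x" using y(2) by blast+
        have "wire_label y = lb y" "wire_label x = lb x" unfolding wire_label_def bv Wire by simp_all
        \<comment> \<open>Over a wire the color contains the full label, so the class of
          \<open>x\<close> is \<open>x\<close> alone.\<close>
        then have "y = x" by (intro cfi_vertex_eqI[OF y(1) x bv]) (simp add: wl)
        then have xw: "(x, w) \<in> parcs (cfi U)" using yw by simp
        then have "bv w \<in> edges `` {Wire b l r}" using Wire by (simp add: cfi_arcs_iff)
        then have "bv w = ?o \<or> bv w = ?i" using nbs_Wire by blast
        then show ?thesis using a c xw by blast
      qed
      then show ?thesis by meson
    next
      case False
      then have "\<exists>l r. bv x = In l r \<or> bv x = Out l r" by (cases "bv x") auto
      then obtain l r where "bv x = In l r \<or> bv x = Out l r" by blast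
      from half_nonblack_neighbors[OF this, of U "half x"] obtain a b c e where
        ab: "\<forall>y w. y \<in> ?V \<longrightarrow> w \<in> ?V \<longrightarrow> (bv y, half y) = (bv x, half x) \<longrightarrow> (y, w) \<in> parcs (cfi U) \<longrightarrow>
      (\<exists>y' w'. y' \<in> ?V \<and> w' \<in> ?V \<and> (bv y', half y') = (bv x, half x) \<and>
        (bv w', half w') = (bv w, half w) \<and> (y', w') \<notin> parcs (cfi U)) \<longrightarrow> w \<in> {a, b, c, e}"
        by (elim exE) (rule that)
      show ?thesis
      proof (rule exI[of _ a], rule exI[of _ b], rule exI[of _ c], rule exI[of _ e], intro allI impI)
        fix y w assume *: "y \<in> ?V" "w \<in> ?V" "(bv y, half y, wire_label y) = (bv x, half x, wire_label x)"
          "(y, w) \<in> parcs (cfi U)"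
          "\<exists>y' w'. y' \<in> ?V \<and> w' \<in> ?V \<and> (bv y', half y', wire_label y') = (bv x, half x, wire_label x) \<and>
            (bv w', half w', wire_label w') = (bv w, half w, wire_label w) \<and> (y', w') \<notin> parcs (cfi U)"
        show "w \<in> {a, b, c, e}"
          by (rule ab[rule_format, OF *(1,2) _ *(4)]) (use *(3,5) in auto)
      qed
    qed
  qed simp
  then have "contractible 4 (cfi U) ((\<lambda>v. {v}) ` ?V)"
    by (subst (asm) color_partition_inj) simp_all
  then show ?thesis by (rule twin_width_le[OF finite_cfi ne])
qed

end

section \<open>Robustness of the network\<close>

context network
begin

lemma card_nbs: "card (edges `` {v}) \<le> 3"
proof -
  have 3: "card A \<le> 3" if "A \<subseteq> {a, b, c}" for A and a b c :: node
    by (rule order_trans[OF card_mono[OF _ that]]) (auto simp: card_insert_if)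
  show ?thesis
  proof (cases v)
    case (In l r)
    show ?thesis unfolding In by (rule 3) (rule nbs_In)
  next
    case (Out l r)
    show ?thesis unfolding Out by (rule 3) (rule nbs_Out)
  next
    case (Wire b l r)
    show ?thesis unfolding Wire by (rule 3) (use nbs_Wire in blast)
  qed
qed

abbreviation rows :: "int set" where "rows \<equiv> {0..<n}"

text \<open>The row reached on level \<open>l\<close> after the binary digits of \<open>z\<close>
  below position \<open>l\<close> have been added.\<close>

definition pos :: "int \<Rightarrow> int \<Rightarrow> nat \<Rightarrow> int" where
  "pos x z l = (x + z mod 2 ^ l) mod n"

text \<open>
  The path from row \<open>x\<close> that winds once around the network and ends in row \<open>x + z\<close>: it takes the
  wires prescribed by the binary digits of \<open>z\<close>.
\<close>

definition track :: "int \<Rightarrow> int \<Rightarrow> node set" where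
  "track x z = insert (In 0 ((x + z) mod n))
    (\<Union>l<d. {In l (pos x z l), Out l (pos x z l), Wire (odd (z div 2 ^ l)) l (pos x z l)})"

lemma pos_rows: "pos x z l \<in> rows"
  by (simp add: pos_def)

lemma pos_0: "x \<in> rows \<Longrightarrow> pos x z 0 = x"
  by (simp add: pos_def)

lemma pos_d: "z \<in> rows \<Longrightarrow> pos x z d = (x + z) mod n"
  by (simp add: pos_def)

lemma pos_Suc: "pos x z (Suc l) = (pos x z l + off (odd (z div 2 ^ l)) l) mod n"
proof -
  have "z mod 2 ^ Suc l = 2 ^ l * (z div 2 ^ l mod 2) + z mod 2 ^ l"
    using zmod_zmult2_eq[of 2 z "2 ^ l"] by (simp add: mult.commute)
  also have "2 ^ l * (z div 2 ^ l mod 2) = off (odd (z div 2 ^ l)) l"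
    by (auto simp: off_def odd_iff_mod_2_eq_one even_iff_mod_2_eq_zero)
  finally have "z mod 2 ^ Suc l = off (odd (z div 2 ^ l)) l + z mod 2 ^ l" .
  then show ?thesis unfolding pos_def mod_add_left_eq by (simp only: ac_simps)
qed

lemma track_linked:
  assumes x: "x \<in> rows" and z: "z \<in> rows" and T: "track x z \<inter> T = {}"
  shows "linked T (In 0 x) (In 0 ((x + z) mod n))"
proof -
  have step: "linked T (In l (pos x z l)) (In (nxt l) (pos x z (Suc l)))" if l: "l < d" for l
  proof -
    let ?p = "pos x z l" and ?b = "odd (z div 2 ^ l)"
    have on: "In l ?p \<in> track x z" "Out l ?p \<in> track x z" "Wire ?b l ?p \<in> track x z"
      using l unfolding track_def by auto
    \<comment> \<open>The last wire returns to level 0 after all of \<open>z\<close> has been added;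
      this endpoint is the vertex that \<open>track\<close> inserts separately.\<close>
    have end_on: "In (nxt l) (pos x z (Suc l)) \<in> track x z"
    proof (cases "Suc l = d")
      case True
      then show ?thesis using pos_d[OF z] unfolding track_def nxt_def by auto
    next
      case False
      then show ?thesis using l unfolding track_def nxt_def by auto
    qed
    have in_nodes: "In l ?p \<in> nodes" "Out l ?p \<in> nodes" "Wire ?b l ?p \<in> nodes"
      "In (nxt l) (pos x z (Suc l)) \<in> nodes"
      using l nxt_less[OF l] pos_rows by (auto simp: nodes_def)
    have "linked T (In l ?p) (Out l ?p)"
      by (rule linked_edge) (use in_nodes on T in \<open>auto simp: edges_def\<close>)
    moreover have "linked T (Out l ?p) (Wire ?b l ?p)"
      by (rule linked_edge) (use in_nodes on T in \<open>auto simp: edges_def\<close>)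
    moreover have "linked T (Wire ?b l ?p) (In (nxt l) (pos x z (Suc l)))"
    proof (rule linked_edge)
      show "(Wire ?b l ?p, In (nxt l) (pos x z (Suc l))) \<in> edges"
        using in_nodes by (simp add: edges_def pos_Suc)
    qed (use on end_on T in auto)
    ultimately show ?thesis by (blast intro: linked_trans)
  qed
  have "linked T (In 0 x) (In l (pos x z l))" if "l < d" for l
    using that
  proof (induction l)
    case 0
    then show ?case using x by (simp add: pos_0 linked_refl)
  next
    case (Suc l)
    then have "linked T (In 0 x) (In l (pos x z l))" "linked T (In l (pos x z l)) (In (Suc l) (pos x z (Suc l)))"
      using step[of l] by (auto simp: nxt_def)
    then show ?case by (rule linked_trans)
  qed
  from this[of "d - 1"] step[of "d - 1"] show ?thesis
    using d_pos pos_d[OF z] by (auto simp: nxt_def intro: linked_trans)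
qed

text \<open>For given \<open>z\<close> the vertex \<open>v\<close> leaves at most two starting rows:
  one if \<open>v\<close> lies on the track at its own level, where a known part of \<open>z\<close>
  has been added, and one if \<open>v\<close> is the endpoint.\<close>

lemma card_tracks_through:
  "card {(x, z) \<in> rows \<times> rows. v \<in> track x z} \<le> 2 * 2 ^ d"
proof -
  let ?f = "\<lambda>z. ((row v - z mod 2 ^ lev v) mod n, z)" and ?g = "\<lambda>z. ((row v - z) mod n, z)"
  have x: "x = (r - y) mod n" if "x \<in> rows" "(x + y) mod n = r" for x y r
    using that by (simp add: mod_diff_left_eq flip: that(2))
  have "{(x, z) \<in> rows \<times> rows. v \<in> track x z} \<subseteq> ?f ` rows \<union> ?g ` rows"
  proof
    fix q assume "q \<in> {(x, z) \<in> rows \<times> rows. v \<in> track x z}"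
    then obtain y z where q: "q = (y, z)" "y \<in> rows" "z \<in> rows" "v \<in> track y z" by blast
    then have "row v = (y + z) mod n \<or> row v = pos y z (lev v)" unfolding track_def by auto
    then have "y = (row v - z) mod n \<or> y = (row v - z mod 2 ^ lev v) mod n"
      using x[OF q(2)] unfolding pos_def by metis
    then show "q \<in> ?f ` rows \<union> ?g ` rows" using q(1,3) by auto
  qed
  then have "card {(x, z) \<in> rows \<times> rows. v \<in> track x z} \<le> card (?f ` rows \<union> ?g ` rows)"
    by (rule card_mono[rotated]) simp
  also have "\<dots> \<le> card (?f ` rows) + card (?g ` rows)" by (rule card_Un_le)
  also have "\<dots> \<le> card rows + card rows" by (intro add_mono card_image_le) simp_all
  finally show ?thesis by (simp add: nat_power_eq)
qed

definition free :: "node set \<Rightarrow> int \<Rightarrow> int set" where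
  "free T x = {z \<in> rows. track x z \<inter> T = {}}"

definition haven :: "node set \<Rightarrow> node set" where
  "haven T = {In 0 x | x. x \<in> rows \<and> 2 ^ d < 2 * card (free T x)}"

lemma finite_free: "finite (free T x)"
  by (rule finite_subset[of _ rows]) (auto simp: free_def)

lemma haven_antimono: "T \<subseteq> T' \<Longrightarrow> haven T' \<subseteq> haven T"
proof -
  assume T: "T \<subseteq> T'"
  have "card (free T' x) \<le> card (free T x)" for x
    by (rule card_mono[OF finite_free]) (use T in \<open>auto simp: free_def\<close>)
  then show ?thesis unfolding haven_def using order_less_le_trans mult_le_mono2 by blast
qed

lemma haven_sub: "haven T \<subseteq> nodes - T"
proof
  fix q assume "q \<in> haven T"
  then obtain x where x: "q = In 0 x" "x \<in> rows" "2 ^ d < 2 * card (free T x)"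
    unfolding haven_def by blast
  then have "card (free T x) \<noteq> 0" by (metis mult_0_right not_less_zero)
  then obtain z where "z \<in> free T x" by (metis card.empty ex_in_conv)
  moreover have "In 0 x \<in> track x z"
    using d_pos pos_0[OF x(2), of z] unfolding track_def by force
  ultimately show "q \<in> nodes - T" using x d_pos by (auto simp: free_def nodes_def)
qed

text \<open>Two rows that each reach more than half of all rows reach a common one.\<close>

lemma haven_linked:
  assumes "q \<in> haven T" "q' \<in> haven T"
  shows "linked T q q'"
proof -
  obtain x where x: "q = In 0 x" "x \<in> rows" "2 ^ d < 2 * card (free T x)"
    using assms(1) unfolding haven_def by blast
  obtain x' where x': "q' = In 0 x'" "x' \<in> rows" "2 ^ d < 2 * card (free T x')"
    using assms(2) unfolding haven_def by blast
  let ?f = "\<lambda>x z. (x + z) mod n"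
  have inj: "inj_on (?f x) (free T x)" for x
  proof (rule inj_onI)
    fix z z' assume z: "z \<in> free T x" "z' \<in> free T x" "(x + z) mod n = (x + z') mod n"
    have "((x + z) mod n - x) mod n = ((x + z') mod n - x) mod n" using z(3) by simp
    then have "z mod n = z' mod n" by (simp add: mod_diff_left_eq)
    then show "z = z'" using z by (simp add: free_def)
  qed
  have "?f x ` free T x \<inter> ?f x' ` free T x' \<noteq> {}"
  proof
    assume disj: "?f x ` free T x \<inter> ?f x' ` free T x' = {}"
    have "card (free T x) + card (free T x') = card (?f x ` free T x \<union> ?f x' ` free T x')"
      using card_Un_disjoint[OF _ _ disj] finite_free card_image[OF inj] by simp
    also have "\<dots> \<le> card rows" by (rule card_mono) auto
    finally show False using x(3) x'(3) by (simp add: nat_power_eq)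
  qed
  then obtain z z' where z: "z \<in> free T x" "z' \<in> free T x'" "(x + z) mod n = (x' + z') mod n" by blast
  have zr: "z \<in> rows" "track x z \<inter> T = {}" "z' \<in> rows" "track x' z' \<inter> T = {}"
    using z(1,2) by (simp_all add: free_def)
  have "linked T q (In 0 ((x + z) mod n))"
    unfolding x(1) by (rule track_linked[OF x(2) zr(1,2)])
  moreover have "linked T (In 0 ((x + z) mod n)) q'"
    unfolding x'(1) z(3) by (rule linked_sym[OF track_linked[OF x'(2) zr(3,4)]])
  ultimately show ?thesis by (rule linked_trans)
qed

text \<open>Double counting of pairs of a start and an offset: \<open>T\<close> blocks at most
  \<open>2 * card T * 2 ^ d\<close> of them, which is less than half of all \<open>4 ^ d\<close>. If
  no row qualified, at most half of the pairs would be free, too few to make up the rest.\<close>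

lemma haven_nonempty:
  assumes T: "finite T" "4 * card T < 2 ^ d"
  shows "haven T \<noteq> {}"
proof
  assume "haven T = {}"
  then have poor: "2 * card (free T x) \<le> 2 ^ d" if "x \<in> rows" for x
    using that unfolding haven_def by (auto simp: not_less[symmetric])
  let ?B = "\<lambda>v. {(x, z) \<in> rows \<times> rows. v \<in> track x z}"
  have finB: "finite (?B v)" for v by (rule finite_subset[of _ "rows \<times> rows"]) auto
  have card_rows: "card rows = 2 ^ d" by (simp add: nat_power_eq)
  have "rows \<times> rows \<subseteq> Sigma rows (free T) \<union> (\<Union>v\<in>T. ?B v)"
    by (auto simp: free_def)
  then have "card (rows \<times> rows) \<le> card (Sigma rows (free T) \<union> (\<Union>v\<in>T. ?B v))"
    by (rule card_mono[rotated]) (intro finite_UnI finite_SigmaI finite_UN_I T(1) finB finite_free, simp)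
  also have "\<dots> \<le> card (Sigma rows (free T)) + card (\<Union>v\<in>T. ?B v)" by (rule card_Un_le)
  also have "card (Sigma rows (free T)) = (\<Sum>x\<in>rows. card (free T x))"
    by (intro card_SigmaI) (simp_all add: finite_free)
  also have "card (\<Union>v\<in>T. ?B v) \<le> (\<Sum>v\<in>T. card (?B v))" by (rule card_UN_le[OF T(1)])
  also have "\<dots> \<le> (\<Sum>v\<in>T. 2 * 2 ^ d)" by (intro sum_mono card_tracks_through)
  also have "\<dots> = 2 * card T * 2 ^ d" by simp
  finally have "2 ^ d * 2 ^ d \<le> (\<Sum>x\<in>rows. card (free T x)) + 2 * card T * 2 ^ d"
    unfolding card_cartesian_product card_rows by simp
  moreover have "2 * (\<Sum>x\<in>rows. card (free T x)) \<le> 2 ^ d * 2 ^ d"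
    unfolding sum_distrib_left
    by (rule order_trans[OF sum_bounded_above[of rows _ "2 ^ d"]]) (simp_all only: poor card_rows, simp)
  moreover have "4 * card T * 2 ^ d < 2 ^ d * 2 ^ d" using T(2) by simp
  ultimately show False by linarith
qed

lemma haven_graph:
  assumes "4 * Suc k < 2 ^ d"
  shows "haven_graph nodes edges k haven"
proof
  show "haven T \<noteq> {}" if "T \<subseteq> nodes" "card T \<le> Suc k" for T
    by (rule haven_nonempty[OF finite_subset[OF that(1) finite_nodes]])
      (rule order.strict_trans1[OF mult_le_mono2[OF that(2)] assms])
  show "haven T \<subseteq> nodes - T" for T by (rule haven_sub)
  show "haven T' \<subseteq> haven T" if "T \<subseteq> T'" for T T' using that by (rule haven_antimono)
  show "linked T q q'" if "q \<in> haven T" "q' \<in> haven T" for T q q' using that by (rule haven_linked)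
qed

text \<open>The factor 32 consists of four nodes per level and row, and at most \<open>2 ^ 3\<close>
  labels for each node of degree at most 3.\<close>

lemma cfi_pair:
  assumes k: "4 * Suc k < 2 ^ d"
  shows "\<exists>G H :: nat pair_pre_digraph. pair_graph G \<and> pair_graph H \<and>
    \<not> digraph_iso (with_proj G) (with_proj H) \<and> twin_width G \<le> 4 \<and> twin_width H \<le> 4 \<and>
    card (pverts G) \<le> 32 * d * 2 ^ d \<and> card (pverts H) \<le> 32 * d * 2 ^ d \<and> \<not> wl_distinguishes k G H"
proof -
  interpret haven_graph nodes edges k haven by (rule haven_graph[OF k])
  obtain u where u: "u \<in> haven {}" using haven_nonempty[of "{}"] by auto
  have uV: "u \<in> nodes" using haven_sub[of "{}"] u by auto
  have "In 0 0 \<in> nodes" "Out 0 0 \<in> nodes" using d_pos by (auto simp: nodes_def)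
  \<comment> \<open>The empty label is admissible over untwisted vertices only, so a base vertex
    different from \<open>u\<close> is chosen for the twisted graph.\<close>
  then have "encode_vertex (In 0 0) {} \<in> pverts (cfi {})"
    "encode_vertex (if u = In 0 0 then Out 0 0 else In 0 0) {} \<in> pverts (cfi {u})"
    by (auto simp: encode_in_cfi_iff)
  then have ne: "pverts (cfi {}) \<noteq> {}" "pverts (cfi {u}) \<noteq> {}" by blast+
  have card: "card (pverts (cfi U)) \<le> 32 * d * 2 ^ d" for U
    using card_cfi[of 3 U] card_nbs card_nodes by (simp add: order_trans[OF _ mult_right_mono])
  show ?thesis
    using pair_graph_cfi not_iso_cfi[OF uV] twin_width_cfi[OF ne(1)] twin_width_cfi[OF ne(2)] card
      not_wl_distinguishes_cfi[OF u] by blast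
qed

end

theorem theorem3p6:
  shows "\<exists>C :: real. \<forall>k :: nat. k \<ge> 2 \<longrightarrow>
    (\<exists>G H :: nat pair_pre_digraph.
       pair_graph G \<and> pair_graph H \<and>
       \<not> digraph_iso (with_proj G) (with_proj H) \<and>
       twin_width G \<le> 4 \<and> twin_width H \<le> 4 \<and>
       real (card (pverts G)) \<le> C * real k * ln (real k) \<and>
       real (card (pverts H)) \<le> C * real k * ln (real k) \<and>
       \<not> wl_distinguishes k G H)"
proof (rule exI[of _ "1920 / ln 2"], intro allI impI)
  \<comment> \<open>The constant is \<open>32 * 5 * 12\<close>: the size is at most
    \<open>32 * d * 2 ^ d\<close>, with \<open>2 ^ d\<close> at most \<open>12 * k\<close> and
    \<open>d\<close> at most \<open>5 * ln k / ln 2\<close>.\<close>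
  fix k :: nat assume k: "2 \<le> k"
  \<comment> \<open>Minimality of \<open>d\<close> bounds \<open>2 ^ d\<close> by
    \<open>8 * Suc k\<close>, which is at most \<open>12 * k\<close> exactly because
    \<open>k\<close> is at least 2.\<close>
  define d where "d = (LEAST d. 4 * Suc k < 2 ^ d)"
  have "4 * Suc k < 2 ^ (4 * Suc k)" by (rule less_exp)
  then have d: "4 * Suc k < 2 ^ d" unfolding d_def by (rule LeastI)
  have "d \<noteq> 0" using d by (cases d) auto
  then obtain d' where d': "d = Suc d'" by (cases d) auto
  then have "\<not> 4 * Suc k < 2 ^ d'" using not_less_Least[of d' "\<lambda>d. 4 * Suc k < 2 ^ d"] unfolding d_def by simp
  then have "2 ^ d \<le> 8 * Suc k" unfolding d' by simp
  also have "\<dots> \<le> 12 * k" using k by simp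
  finally have pow: "2 ^ d \<le> 12 * k" .
  have "(2::real) ^ d = real (2 ^ d)" by simp
  also have "\<dots> \<le> 12 * real k" using pow by linarith
  finally have pow': "(2::real) ^ d \<le> 12 * real k" .
  \<comment> \<open>The factor 12 is rounded up to \<open>2 ^ 4\<close>, and the four copies of
    \<open>ln 2\<close> are absorbed into \<open>ln k\<close>, again by \<open>k\<close> being at
    least 2.\<close>
  have "real d * ln 2 = ln (2 ^ d)" by (simp add: ln_realpow)
  also have "\<dots> \<le> ln (2 ^ 4 * real k)" using pow' k by (subst ln_le_cancel_iff) auto
  also have "\<dots> = ln (2 ^ 4) + ln (real k)" by (rule ln_mult_pos) (use k in auto)
  also have "ln (2 ^ 4 :: real) = 4 * ln 2" by (subst ln_realpow) simp_all
  also have "ln 2 \<le> ln (real k)" using k by simp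
  finally have "real d * ln 2 \<le> 5 * ln (real k)" by simp
  then have d_le: "real d \<le> 5 * ln (real k) / ln 2" by (simp add: field_simps)
  interpret network d by unfold_locales (use \<open>d \<noteq> 0\<close> in simp)
  have "real (32 * d * 2 ^ d) = 32 * (real d * 2 ^ d)" by simp
  also have "\<dots> \<le> 32 * (5 * ln (real k) / ln 2 * (12 * real k))"
    using d_le pow' k by (intro mult_left_mono mult_mono) auto
  finally have size: "real (32 * d * 2 ^ d) \<le> 1920 / ln 2 * real k * ln (real k)"
    by (simp add: field_simps)
  have "real m \<le> 1920 / ln 2 * real k * ln (real k)" if "m \<le> 32 * d * 2 ^ d" for m
    using order_trans[OF _ size, of "real m"] that by (simp only: of_nat_le_iff)
  then show "\<exists>G H :: nat pair_pre_digraph.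
       pair_graph G \<and> pair_graph H \<and>
       \<not> digraph_iso (with_proj G) (with_proj H) \<and>
       twin_width G \<le> 4 \<and> twin_width H \<le> 4 \<and>
       real (card (pverts G)) \<le> 1920 / ln 2 * real k * ln (real k) \<and>
       real (card (pverts H)) \<le> 1920 / ln 2 * real k * ln (real k) \<and>
       \<not> wl_distinguishes k G H"
    using cfi_pair[OF d] by meson
qed

end
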